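(* Up to transposition and anti-transposition, the 1-variable TN obstructions are exactly the $2\times 2$ pattern whose only unspecified position is $(1,1)$, and the $4\times 4$ pattern whose only unspecified position is $(1,4)$.
   Context: A pattern is a rectangular array of positions each marked "specified" or "unspecified". A partial matrix with a pattern assigns real numbers to the specified positions; it is partial TN if every square submatrix (arbitrary, not necessarily contiguous, rows and columns) consisting only of specified entries has nonnegative determinant. A pattern is TN-completable if every partial TN matrix with that pattern can have its unspecified entries filled with reals so that the result is totally nonnegative (all minors nonnegative). A subset $U$ of the unspecified positions is TN-completable if for every partial TN matrix with the pattern, real values can be assigned to the positions of $U$ so that the resulting partial matrix is still partial TN. The variability of a non-TN-completable pattern is the smallest size of a subset of its unspecified positions that is not TN-completable. A TN obstruction is a pattern that is not TN-completable but every pattern obtained from it by deleting at least one row or column (i.e. every proper submatrix pattern) is TN-completable; it is 1-variable if its variability is 1. The transpose of a pattern reflects it across the main diagonal; the anti-transpose reflects an $m\times n$ pattern by sending position $(i,j)$ to $(n+1-j,m+1-i)$. *)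

theory Defs
  imports "Jordan_Normal_Form.Determinant" "Jordan_Normal_Form.DL_Submatrix"
begin

text \<open>
  A pattern is a \<open>bool mat\<close>, where \<open>True\<close> marks a specified position. Matrix indices are 0-based, so
  position \<open>(i, j)\<close> in 1-based notation is \<open>(i - 1, j - 1)\<close> here.

  A partial matrix with pattern \<open>P\<close> is represented by a real matrix of the same dimensions, whose
  entries at unspecified positions are irrelevant: no definition below inspects them.
\<close>

definition unspecified :: "bool mat \<Rightarrow> (nat \<times> nat) set" where
  "unspecified P = {(i, j). i < dim_row P \<and> j < dim_col P \<and> \<not> P $$ (i, j)}"

definition totally_nonneg :: "real mat \<Rightarrow> bool" where
  "totally_nonneg A \<longleftrightarrow>
     (\<forall>I \<subseteq> {..<dim_row A}. \<forall>J \<subseteq> {..<dim_col A}.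
        card I = card J \<longrightarrow> 0 \<le> det (submatrix A I J))"

definition partial_TN :: "bool mat \<Rightarrow> real mat \<Rightarrow> bool" where
  "partial_TN P A \<longleftrightarrow>
     A \<in> carrier_mat (dim_row P) (dim_col P) \<and>
     (\<forall>I \<subseteq> {..<dim_row P}. \<forall>J \<subseteq> {..<dim_col P}.
        card I = card J \<and> (\<forall>i \<in> I. \<forall>j \<in> J. P $$ (i, j)) \<longrightarrow> 0 \<le> det (submatrix A I J))"

definition agree_on_specified :: "bool mat \<Rightarrow> real mat \<Rightarrow> real mat \<Rightarrow> bool" where
  "agree_on_specified P A B \<longleftrightarrow>
     (\<forall>i < dim_row P. \<forall>j < dim_col P. P $$ (i, j) \<longrightarrow> B $$ (i, j) = A $$ (i, j))"

definition TN_completable :: "bool mat \<Rightarrow> bool" where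
  "TN_completable P \<longleftrightarrow>
     (\<forall>A. partial_TN P A \<longrightarrow>
        (\<exists>B \<in> carrier_mat (dim_row P) (dim_col P). agree_on_specified P A B \<and> totally_nonneg B))"

definition specify :: "bool mat \<Rightarrow> (nat \<times> nat) set \<Rightarrow> bool mat" where
  "specify P U = mat (dim_row P) (dim_col P) (\<lambda>(i, j). P $$ (i, j) \<or> (i, j) \<in> U)"

definition TN_completable_subset :: "bool mat \<Rightarrow> (nat \<times> nat) set \<Rightarrow> bool" where
  "TN_completable_subset P U \<longleftrightarrow>
     (\<forall>A. partial_TN P A \<longrightarrow> (\<exists>B. agree_on_specified P A B \<and> partial_TN (specify P U) B))"

text \<open>
  Meaningful only if \<open>P\<close> is not TN-completable; then the set of all unspecified positions is a
  candidate for \<open>U\<close>, so the minimum exists.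
\<close>

definition variability :: "bool mat \<Rightarrow> nat" where
  "variability P =
     (LEAST k. \<exists>U \<subseteq> unspecified P. \<not> TN_completable_subset P U \<and> card U = k)"

text \<open>
  \<open>I\<close> and \<open>J\<close> are the rows and columns that are kept. Deleting all rows or all columns is
  harmless, since a pattern with no positions is TN-completable.
\<close>

definition TN_obstruction :: "bool mat \<Rightarrow> bool" where
  "TN_obstruction P \<longleftrightarrow>
     \<not> TN_completable P \<and>
     (\<forall>I \<subseteq> {..<dim_row P}. \<forall>J \<subseteq> {..<dim_col P}.
        (I \<noteq> {..<dim_row P} \<or> J \<noteq> {..<dim_col P}) \<longrightarrow> TN_completable (submatrix P I J))"

definition one_variable_TN_obstruction :: "bool mat \<Rightarrow> bool" where
  "one_variable_TN_obstruction P \<longleftrightarrow> TN_obstruction P \<and> variability P = 1"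

text \<open>
  For an \<open>m \<times> n\<close> pattern, 1-based position \<open>(i, j)\<close> moves to \<open>(n + 1 - j, m + 1 - i)\<close>; so the
  0-based entry \<open>(i, j)\<close> of the result comes from \<open>(m - 1 - j, n - 1 - i)\<close>.
\<close>

definition anti_transpose_mat :: "'a mat \<Rightarrow> 'a mat" where
  "anti_transpose_mat P =
     mat (dim_col P) (dim_row P) (\<lambda>(i, j). P $$ (dim_row P - 1 - j, dim_col P - 1 - i))"

text \<open>Both reflections are involutions, so this reflexive transitive closure is an equivalence.\<close>

definition pattern_equiv :: "bool mat \<Rightarrow> bool mat \<Rightarrow> bool" where
  "pattern_equiv = (\<lambda>P Q. Q = transpose_mat P \<or> Q = anti_transpose_mat P)\<^sup>*\<^sup>*"

definition single_unspecified :: "nat \<Rightarrow> nat \<Rightarrow> nat \<times> nat \<Rightarrow> bool mat" where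
  "single_unspecified m n p = mat m n (\<lambda>q. q \<noteq> p)"

end

(* Filling a single position (s, t) is a linear feasibility problem: every minor through (s, t) whose
   other entries are specified is an affine constraint on the missing entry x. In an obstruction
   other than the 2-by-2 ones, (s, t) is a corner, say the upper right one, of all these minors. As
   long as no minor of size at least 4 occurs, x has to satisfy only 0 <= x, the upper bounds
   x <= A(s,j) A(i,t) / A(i,j) from the 2-by-2 minors and the lower bounds from the 3-by-3 minors.
   Polynomial identities show that every such lower bound is below every such upper bound, so the
   largest lower bound can be used as x. Hence a minor of size at least 4 occurs, and the pattern is
   the 4-by-4 one. Conversely, a proper subpattern of the 4-by-4 pattern has at most three rows or at
   most three columns, so the same argument completes it. *)

theory Submission
  imports Defs
begin

section \<open>Compatibility of the constraints at a corner\<close>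

text \<open>In a k-by-k minor the cofactor of the upper right entry carries the sign (-1)^(k-1), and
  the complementary minor is nonnegative. Where it does not vanish, minors of odd size therefore
  bound the missing entry from below and minors of even size bound it from above. Up to size 3 the
  only serious conflict is between sizes 3 and 2. The identities that exclude it mention further
  minors, whose entries have to be specified; the absence of the 2-by-2 obstructions guarantees
  this. Size 4 brings a new kind of upper bound, which can be negative: the matrix used for the
  4-by-4 pattern forces x <= -1 against 0 <= x. Bounds are compared in multiplied form because
  denominators may vanish. A minor whose slope is 0 does not involve x at all and must be shown to
  be nonnegative by itself. A position might also be the upper right entry of some minors and the
  lower left entry of others. In an obstruction this is impossible: a non-completable 3-by-2 pattern
  with two gaps would then be a proper subpattern.\<close>

text \<open>For positive \<open>D\<close> and \<open>q\<close> this is a chain of quotients: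
  \<open>N / D\<close> is below \<open>u * z / y\<close>, which by \<open>u / y <= p / q\<close> is
  below \<open>p * z / q\<close>. It carries a bound over from one entry to another.\<close>

lemma scale_cancel:
  fixes N D :: real
  assumes "N * y \<le> D * (u * z)" "u * q \<le> p * y" "0 < y" "0 \<le> D" "0 \<le> z" "0 \<le> q"
  shows "N * q \<le> D * (p * z)"
proof -
  have "N * q * y \<le> D * (u * z) * q"
    using mult_right_mono[OF assms(1) assms(6)] by (simp add: ac_simps)
  also have "\<dots> = (D * z) * (u * q)" by (simp add: ac_simps)
  also have "\<dots> \<le> (D * z) * (p * y)"
    using assms by (intro mult_left_mono) auto
  finally have "N * q * y \<le> D * (p * z) * y" by (simp add: ac_simps)
  then show ?thesis using \<open>0 < y\<close> by simp
qed

text \<open>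
  The specified part of a matrix with rows \<open>(a, b, x)\<close>, \<open>(c, d, e)\<close>, \<open>(f, g, h)\<close> and unknown
  corner \<open>x\<close>, whose determinant is \<open>x * D - N\<close>.
\<close>

locale TN33_corner =
  fixes a b c d e f g h :: real
  assumes nonneg: "0 \<le> a" "0 \<le> b" "0 \<le> c" "0 \<le> d" "0 \<le> e" "0 \<le> f" "0 \<le> g" "0 \<le> h"
    and minors: "b * c \<le> a * d" "b * f \<le> a * g" "d * f \<le> c * g" "e * f \<le> c * h" "e * g \<le> d * h"
begin

definition D where "D = c * g - d * f"
definition N where "N = b * (c * h - e * f) - a * (d * h - e * g)"

lemma D_nonneg: "0 \<le> D" using minors by (simp add: D_def)

text \<open>With zero slope the minor is the constant \<open>- N\<close>. Sylvester's identity with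
  pivot \<open>d\<close>, taken at \<open>x = 0\<close>, gives its sign for positive
  \<open>d\<close>. For \<open>d = 0\<close> the products \<open>e * g\<close> and
  \<open>b * c\<close> vanish and \<open>N\<close> reduces to \<open>- (b * e * f)\<close>.\<close>

lemma singular: "D = 0 \<Longrightarrow> N \<le> 0"
proof (cases "d = 0")
  case True
  then have "e * g = 0" "b * c = 0"
    using minors nonneg by (auto simp: mult_le_0_iff not_less intro: antisym)
  moreover have "N = (b * c) * h - b * e * f - a * d * h + a * (e * g)"
    by (simp add: N_def algebra_simps)
  ultimately show ?thesis using True nonneg by (simp del: mult_eq_0_iff)
next
  case False
  assume "D = 0"
  have "d * - N = (a * d - b * c) * (d * h - e * g) - b * e * D"
    by (simp add: N_def D_def algebra_simps)
  then have "0 \<le> d * - N" using \<open>D = 0\<close> minors by simp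
  then show ?thesis using False nonneg by (simp add: mult_le_0_iff)
qed

text \<open>Sylvester's identity with pivot \<open>c\<close> reads \<open>c * (x * D - N) = (a * d -
  b * c) * (c * h - e * f) - (a * e - x * c) * D\<close>, and the first product consists of
  nonnegative minors. The next three bounds arise in the same way from the pivots \<open>d\<close>,
  \<open>f\<close> and \<open>g\<close>.\<close>

lemma bound_c: "N * c \<le> D * (a * e)"
proof -
  have "D * (a * e) - N * c = (a * d - b * c) * (c * h - e * f)"
    by (simp add: N_def D_def algebra_simps)
  also have "\<dots> \<ge> 0" using minors by simp
  finally show ?thesis by simp
qed

lemma bound_d: "N * d \<le> D * (b * e)"
proof -
  have "D * (b * e) - N * d = (a * d - b * c) * (d * h - e * g)"
    by (simp add: N_def D_def algebra_simps)
  also have "\<dots> \<ge> 0" using minors by simp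
  finally show ?thesis by simp
qed

lemma bound_f: "N * f \<le> D * (a * h)"
proof -
  have "D * (a * h) - N * f = (a * g - b * f) * (c * h - e * f)"
    by (simp add: N_def D_def algebra_simps)
  also have "\<dots> \<ge> 0" using minors by simp
  finally show ?thesis by simp
qed

lemma bound_g: "N * g \<le> D * (b * h)"
proof -
  have "D * (b * h) - N * g = (a * g - b * f) * (d * h - e * g)"
    by (simp add: N_def D_def algebra_simps)
  also have "\<dots> \<ge> 0" using minors by simp
  finally show ?thesis by simp
qed

text \<open>Fallback for degenerate cases, where an entry needed as a denominator is 0: the lower
  bound is then not positive, while all upper bounds are nonnegative.\<close>

lemma N_nonpos: "b = 0 \<Longrightarrow> N \<le> 0" "h = 0 \<Longrightarrow> N \<le> 0"
proof -
  show "b = 0 \<Longrightarrow> N \<le> 0" unfolding N_def using nonneg minors by (auto simp: mult.commute)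
  assume "h = 0"
  then have "e * g = 0" using minors(5) nonneg by (auto simp: mult_le_0_iff intro: antisym)
  then have "N = - (b * (e * f))" unfolding N_def using \<open>h = 0\<close> by (auto simp: ac_simps)
  then show "N \<le> 0" using nonneg by simp
qed

lemma nonpos_bound: "N \<le> 0 \<Longrightarrow> 0 < D \<Longrightarrow> 0 \<le> q \<Longrightarrow> 0 \<le> p \<Longrightarrow> 0 \<le> z \<Longrightarrow> N * q \<le> D * (p * z)"
  by (meson mult_nonneg_nonneg mult_nonpos_nonneg order_trans less_imp_le)

lemma b_eq_0: "0 < D \<Longrightarrow> a = 0 \<Longrightarrow> b = 0"
proof -
  assume "0 < D" "a = 0"
  then have "c \<noteq> 0" using nonneg by (auto simp: D_def dest: mult_nonneg_nonneg[of d f])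
  then show ?thesis using \<open>a = 0\<close> minors(1) nonneg by (auto simp: mult_le_0_iff)
qed

text \<open>
  A further column \<open>(p, q, r)\<close> bounds \<open>x\<close> from above by \<open>p * e / q\<close> and by \<open>p * h / r\<close>. The three
  alternatives of the last hypothesis correspond to a column left of, between, or right of the
  columns \<open>(a, c, f)\<close> and \<open>(b, d, g)\<close>.
\<close>

lemma extra_column:
  assumes "0 < D" "0 \<le> p" "0 < q"
    and "a * q \<le> p * c \<or> b * q \<le> p * d \<or>
      (b * (c * r - q * f) - a * (d * r - q * g) \<le> p * D \<and> e * r \<le> q * h)"
  shows "N * q \<le> D * (p * e)"
  using assms(4)
proof (elim disjE conjE)
  assume *: "a * q \<le> p * c"
  have "0 < c" using \<open>0 < D\<close> nonneg
    by (metis D_def diff_le_0_iff_le mult_nonneg_nonneg mult_zero_left not_le order_le_less)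
  then show ?thesis using scale_cancel[OF bound_c *] assms nonneg by simp
next
  assume *: "b * q \<le> p * d"
  show ?thesis
  proof (cases "d = 0")
    case True
    then have "b = 0" using * assms nonneg by (auto simp: mult_le_0_iff)
    then show ?thesis using N_nonpos nonpos_bound assms nonneg by simp
  next
    case False
    then show ?thesis using scale_cancel[OF bound_d *] assms nonneg by simp
  qed
next
  assume K: "b * (c * r - q * f) - a * (d * r - q * g) \<le> p * D" and r: "e * r \<le> q * h"
  have "0 \<le> (a * d - b * c) * (q * h - e * r)" using r minors by simp
  \<comment> \<open>Both offsets are, up to sign, determinants with last columns
    \<open>(0, q, r)\<close> and \<open>(0, e, h)\<close>. Combining these columns with factors
    \<open>e\<close> and \<open>- q\<close> clears the second entry, so by linearity a product of
    two 2-by-2 minors remains.\<close>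
  also have "\<dots> = e * (b * (c * r - q * f) - a * (d * r - q * g)) - N * q"
    by (simp add: N_def algebra_simps)
  also have "\<dots> \<le> e * (p * D) - N * q"
    using mult_left_mono[OF K nonneg(5)] by simp
  finally show ?thesis by (simp add: ac_simps)
qed

lemma extra_column':
  assumes "0 < D" "0 \<le> p" "0 < r"
    and "a * r \<le> p * f \<or> b * r \<le> p * g \<or>
      (b * (c * r - q * f) - a * (d * r - q * g) \<le> p * D \<and> e * r \<le> q * h)"
  shows "N * r \<le> D * (p * h)"
  using assms(4)
proof (elim disjE conjE)
  assume *: "a * r \<le> p * f"
  show ?thesis
  proof (cases "f = 0")
    case True
    then have "a = 0" using * assms nonneg by (auto simp: mult_le_0_iff)
    then show ?thesis using b_eq_0 N_nonpos nonpos_bound assms nonneg by simp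
  next
    case False
    then show ?thesis using scale_cancel[OF bound_f *] assms nonneg by simp
  qed
next
  assume *: "b * r \<le> p * g"
  have "0 < g" using \<open>0 < D\<close> nonneg
    by (metis D_def diff_le_0_iff_le mult_nonneg_nonneg mult_zero_right not_le order_le_less)
  then show ?thesis using scale_cancel[OF bound_g *] assms nonneg by simp
next
  assume K: "b * (c * r - q * f) - a * (d * r - q * g) \<le> p * D" and r: "e * r \<le> q * h"
  have "0 \<le> (a * g - b * f) * (q * h - e * r)" using r minors by simp
  \<comment> \<open>The same combination with factors \<open>h\<close> and \<open>- r\<close>, which
    clears the third entry instead.\<close>
  also have "\<dots> = h * (b * (c * r - q * f) - a * (d * r - q * g)) - N * r"
    by (simp add: N_def algebra_simps)
  also have "\<dots> \<le> h * (p * D) - N * r"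
    using mult_left_mono[OF K nonneg(8)] by simp
  finally show ?thesis by (simp add: ac_simps)
qed

end

text \<open>Reflection in the anti-diagonal fixes the unknown corner and leaves \<open>D\<close> and
  \<open>N\<close> unchanged. Hence the results on a further column also serve for a further
  row.\<close>

lemma TN33_corner_anti_transpose:
  assumes "TN33_corner a b c d e f g h"
  shows "TN33_corner h e g d b f c a"
  using assms by (simp add: TN33_corner_def mult.commute)

text \<open>
  A 3-by-3 minor with rows \<open>i1, i2, i3\<close> and columns \<open>j1, j2, j3\<close>, read as an affine function of its
  upper right entry: \<open>A i1 j3 * corner_slope A i2 i3 j1 j2 - corner_offset A i1 j3 i2 i3 j1 j2\<close>.
\<close>

definition corner_slope where
  "corner_slope (A :: nat \<Rightarrow> nat \<Rightarrow> real) i2 i3 j1 j2 = A i2 j1 * A i3 j2 - A i2 j2 * A i3 j1"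
definition corner_offset where
  "corner_offset (A :: nat \<Rightarrow> nat \<Rightarrow> real) s t i2 i3 j1 j2 =
     A s j2 * (A i2 j1 * A i3 t - A i2 t * A i3 j1) - A s j1 * (A i2 j2 * A i3 t - A i2 t * A i3 j2)"

text \<open>
  In terms of patterns: no 2-by-2 subpattern has exactly one unspecified position on its main
  diagonal and none off it.
\<close>

definition diagonally_linked :: "(nat \<Rightarrow> nat \<Rightarrow> bool) \<Rightarrow> bool" where
  "diagonally_linked P \<longleftrightarrow>
     (\<forall>i i' j j'. i < i' \<longrightarrow> j < j' \<longrightarrow> P i j' \<longrightarrow> P i' j \<longrightarrow> (P i j \<longleftrightarrow> P i' j'))"

text \<open>Together with \<open>s\<close> and \<open>t\<close> the index sets span a 4-by-4
  subpattern with \<open>(s, t)\<close> in its upper right corner. Size 4 is enough to detect larger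
  minors, since each of them contains such a subpattern with the same corner.\<close>

definition large_corner :: "(nat \<Rightarrow> nat \<Rightarrow> bool) \<Rightarrow> nat \<Rightarrow> nat \<Rightarrow> bool" where
  "large_corner P s t \<longleftrightarrow>
     (\<exists>I \<subseteq> {s<..}. \<exists>J \<subseteq> {..<t}. card I = 3 \<and> card J = 3 \<and>
        (\<forall>i \<in> insert s I. \<forall>j \<in> insert t J. (i, j) \<noteq> (s, t) \<longrightarrow> P i j))"

section \<open>Filling a single upper right entry\<close>

text \<open>Matrices are replaced by functions on all pairs of indices, with \<open>P\<close> false
  outside the range, so that no bounds on indices have to be carried along. Finiteness of
  \<open>P\<close> makes a largest lower bound exist.\<close>

locale corner =
  fixes P :: "nat \<Rightarrow> nat \<Rightarrow> bool" and A :: "nat \<Rightarrow> nat \<Rightarrow> real" and s t :: nat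
  assumes finite_P: "finite {(i, j). P i j}"
    and nonneg: "P i j \<Longrightarrow> 0 \<le> A i j"
    and minor2: "i < i' \<Longrightarrow> j < j' \<Longrightarrow> P i j \<Longrightarrow> P i j' \<Longrightarrow> P i' j \<Longrightarrow> P i' j' \<Longrightarrow>
      A i j' * A i' j \<le> A i j * A i' j'"
    and minor3: "i1 < i2 \<Longrightarrow> i2 < i3 \<Longrightarrow> j1 < j2 \<Longrightarrow> j2 < j3 \<Longrightarrow>
      \<forall>i \<in> {i1, i2, i3}. \<forall>j \<in> {j1, j2, j3}. P i j \<Longrightarrow>
      corner_offset A i1 j3 i2 i3 j1 j2 \<le> A i1 j3 * corner_slope A i2 i3 j1 j2"
    and linked: "diagonally_linked P"
    and not_large: "\<not> large_corner P s t"
begin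

lemma
  assumes "i < i'" "j < j'" "P i j'" "P i' j"
  shows linked_upper: "P i' j' \<Longrightarrow> P i j" and linked_lower: "P i j \<Longrightarrow> P i' j'"
  using linked assms unfolding diagonally_linked_def by blast+

text \<open>A frame is a 3-by-3 minor through \<open>(s, t)\<close> whose other eight entries are
  known. If its slope is positive, it contributes the lower bound
  \<open>offset / slope\<close>.\<close>

definition frame where
  "frame i2 i3 j1 j2 \<longleftrightarrow> s < i2 \<and> i2 < i3 \<and> j1 < j2 \<and> j2 < t \<and>
     P s j1 \<and> P s j2 \<and> P i2 j1 \<and> P i2 j2 \<and> P i2 t \<and> P i3 j1 \<and> P i3 j2 \<and> P i3 t"

lemma frame_TN33:
  assumes "frame i2 i3 j1 j2"
  shows "TN33_corner (A s j1) (A s j2) (A i2 j1) (A i2 j2) (A i2 t) (A i3 j1) (A i3 j2) (A i3 t)"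
  using assms unfolding frame_def TN33_corner_def
  by (auto intro!: nonneg minor2)

abbreviation "slope i2 i3 j1 j2 \<equiv> corner_slope A i2 i3 j1 j2"
abbreviation "offset i2 i3 j1 j2 \<equiv> corner_offset A s t i2 i3 j1 j2"

lemma
  assumes "frame i2 i3 j1 j2"
  shows slope_nonneg: "0 \<le> slope i2 i3 j1 j2"
    and offset_singular: "slope i2 i3 j1 j2 = 0 \<Longrightarrow> offset i2 i3 j1 j2 \<le> 0"
proof -
  interpret T: TN33_corner "A s j1" "A s j2" "A i2 j1" "A i2 j2" "A i2 t" "A i3 j1" "A i3 j2" "A i3 t"
    using frame_TN33[OF assms] .
  show "0 \<le> slope i2 i3 j1 j2" "slope i2 i3 j1 j2 = 0 \<Longrightarrow> offset i2 i3 j1 j2 \<le> 0"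
    using T.D_nonneg T.singular by (auto simp: T.D_def T.N_def corner_slope_def corner_offset_def)
qed

text \<open>The upper bound comes from a row of the frame, so only column \<open>j\<close> can be
  new. Its place relative to \<open>j1\<close> and \<open>j2\<close> selects the alternative in
  \<open>extra_column\<close> or \<open>extra_column'\<close>.\<close>

lemma compat_row:
  assumes fr: "frame i2 i3 j1 j2" and pos: "0 < slope i2 i3 j1 j2" "0 < A i j"
    and i: "i \<in> {i2, i3}" and j: "j < t" "P s j" "P i j"
  shows "offset i2 i3 j1 j2 * A i j \<le> slope i2 i3 j1 j2 * (A s j * A i t)"
proof -
  interpret T: TN33_corner "A s j1" "A s j2" "A i2 j1" "A i2 j2" "A i2 t" "A i3 j1" "A i3 j2" "A i3 t"
    using frame_TN33[OF fr] .
  have D: "T.D = slope i2 i3 j1 j2" and N: "T.N = offset i2 i3 j1 j2"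
    by (auto simp: T.D_def T.N_def corner_slope_def corner_offset_def)
  note fr = fr[unfolded frame_def]
  have right: "A s j2 * (A i2 j1 * A i3 j - A i2 j * A i3 j1) - A s j1 * (A i2 j2 * A i3 j - A i2 j * A i3 j2)
      \<le> A s j * T.D \<and> A i2 t * A i3 j \<le> A i2 j * A i3 t" if "j2 < j"
  proof -
    \<comment> \<open>A column to the right of \<open>j2\<close> needs both frame rows for the
      3-by-3 minor with columns \<open>j1\<close>, \<open>j2\<close>, \<open>j\<close>. One of the
      two entries is given and linkedness supplies the other.\<close>
    have "P i2 j \<and> P i3 j"
      using i linked_lower[of i2 i3 j2 j] linked_upper[of i2 i3 j t] fr j that by auto
    then show ?thesis
      using minor3[of s i2 i3 j1 j2 j] minor2[of i2 i3 j t] fr j that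
      by (auto simp: D corner_offset_def)
  qed
  consider "j = j1" | "j = j2" | "j < j1" | "j1 < j" "j < j2" | "j2 < j" by linarith
  note cs = this
  from i consider "i = i2" | "i = i3" by auto
  then show ?thesis
  proof cases
    case 1
    have "A s j1 * A i2 j \<le> A s j * A i2 j1 \<or> A s j2 * A i2 j \<le> A s j * A i2 j2 \<or> j2 < j"
      using minor2[of s i2 j j1] minor2[of s i2 j j2] fr j 1 by (cases rule: cs) auto
    then show ?thesis
      using T.extra_column[of "A s j" "A i2 j" "A i3 j"] right pos j nonneg 1 unfolding D N by auto
  next
    case 2
    have "A s j1 * A i3 j \<le> A s j * A i3 j1 \<or> A s j2 * A i3 j \<le> A s j * A i3 j2 \<or> j2 < j"
      using minor2[of s i3 j j1] minor2[of s i3 j j2] fr j 2 by (cases rule: cs) auto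
    then show ?thesis
      using T.extra_column'[of "A s j" "A i3 j" "A i2 j"] right pos j nonneg 2 unfolding D N by auto
  qed
qed

text \<open>Mirror image of the row version: in the reflected frame the rows, read from bottom to
  top, become columns, and row \<open>i\<close> is the further column.\<close>

lemma compat_col:
  assumes fr: "frame i2 i3 j1 j2" and pos: "0 < slope i2 i3 j1 j2" "0 < A i j"
    and j: "j \<in> {j1, j2}" and i: "s < i" "P i t" "P i j"
  shows "offset i2 i3 j1 j2 * A i j \<le> slope i2 i3 j1 j2 * (A s j * A i t)"
proof -
  interpret T: TN33_corner "A i3 t" "A i2 t" "A i3 j2" "A i2 j2" "A s j2" "A i3 j1" "A i2 j1" "A s j1"
    using TN33_corner_anti_transpose[OF frame_TN33[OF fr]] .
  have D: "T.D = slope i2 i3 j1 j2" and N: "T.N = offset i2 i3 j1 j2"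
    by (auto simp: T.D_def T.N_def corner_slope_def corner_offset_def algebra_simps)
  note fr = fr[unfolded frame_def]
  have above: "A i2 t * (A i3 j2 * A i j1 - A i j2 * A i3 j1) - A i3 t * (A i2 j2 * A i j1 - A i j2 * A i2 j1)
      \<le> A i t * T.D \<and> A s j2 * A i j1 \<le> A i j2 * A s j1" if "i < i2"
  proof -
    have "P i j1 \<and> P i j2"
      using j linked_upper[of i i2 j1 j2] linked_lower[of s i j1 j2] fr i that by auto
    then show ?thesis
      using minor3[of i i2 i3 j1 j2 t] minor2[of s i j1 j2] fr i that
      by (auto simp: D corner_offset_def algebra_simps)
  qed
  consider "i = i2" | "i = i3" | "i3 < i" | "i2 < i" "i < i3" | "i < i2" by linarith
  note cs = this
  from j consider "j = j1" | "j = j2" by auto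
  then show ?thesis
  proof cases
    case 1
    have "A i3 t * A i j1 \<le> A i t * A i3 j1 \<or> A i2 t * A i j1 \<le> A i t * A i2 j1 \<or> i < i2"
      using minor2[of i3 i j1 t] minor2[of i2 i j1 t] fr i 1 by (cases rule: cs) (auto simp: mult.commute)
    then show ?thesis
      using T.extra_column'[of "A i t" "A i j1" "A i j2"] above pos i nonneg 1 unfolding D N
      by (auto simp: mult.commute)
  next
    case 2
    have "A i3 t * A i j2 \<le> A i t * A i3 j2 \<or> A i2 t * A i j2 \<le> A i t * A i2 j2 \<or> i < i2"
      using minor2[of i3 i j2 t] minor2[of i2 i j2 t] fr i 2 by (cases rule: cs) (auto simp: mult.commute)
    then show ?thesis
      using T.extra_column[of "A i t" "A i j2" "A i j1"] above pos i nonneg 2 unfolding D N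
      by (auto simp: mult.commute)
  qed
qed

text \<open>If neither \<open>i\<close> nor \<open>j\<close> belongs to the frame, the bound from
  \<open>(i, j)\<close> is compared with one from an entry that shares a row or a column with the
  frame. This works when row \<open>i\<close> or column \<open>j\<close> misses an entry of the
  frame, because linkedness then fixes on which side it lies. If nothing is missing, frame, row and
  column form the excluded 4-by-4 subpattern.\<close>

lemma compat:
  assumes fr: "frame i2 i3 j1 j2" and pos: "0 < slope i2 i3 j1 j2"
    and ij: "s < i" "j < t" "P s j" "P i j" "P i t"
  shows "offset i2 i3 j1 j2 * A i j \<le> slope i2 i3 j1 j2 * (A s j * A i t)"
proof (cases "A i j = 0 \<or> i \<in> {i2, i3} \<or> j \<in> {j1, j2}")
  case True
  then show ?thesis
    using compat_row[OF fr pos, of i j] compat_col[OF fr pos, of i j] nonneg ij pos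
    by (cases "A i j = 0") (auto simp: order_less_le)
next
  case False
  then have ij': "0 < A i j" "i \<noteq> i2" "i \<noteq> i3" "j \<noteq> j1" "j \<noteq> j2"
    using nonneg[OF \<open>P i j\<close>] by auto
  interpret T: TN33_corner "A s j1" "A s j2" "A i2 j1" "A i2 j2" "A i2 t" "A i3 j1" "A i3 j2" "A i3 t"
    using frame_TN33[OF fr] .
  have D: "T.D = slope i2 i3 j1 j2" and N: "T.N = offset i2 i3 j1 j2"
    by (auto simp: T.D_def T.N_def corner_slope_def corner_offset_def)
  note fr' = fr[unfolded frame_def]
  consider (row) k where "k \<in> {j1, j2}" "\<not> P i k" | (col) k where "k \<in> {i2, i3}" "\<not> P k j"
    | (full) "P i j1" "P i j2" "P i2 j" "P i3 j"
    by blast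
  then show ?thesis
  proof cases
    case row
    \<comment> \<open>Row \<open>i\<close> then lies below the frame, and its bound is weaker than the one given by row \<open>i3\<close>.\<close>
    have "i3 < i"
    proof (rule ccontr)
      assume "\<not> i3 < i"
      moreover have "i \<noteq> i3" using row ij' by auto
      ultimately show False using linked_upper[of i i3 k t] row fr' ij by auto
    qed
    moreover have "k < j"
    proof (rule ccontr)
      assume "\<not> k < j"
      moreover have "j \<noteq> k" using row ij' by auto
      ultimately show False using linked_lower[of s i j k] row fr' ij by auto
    qed
    then have "P i3 j"
      using linked_lower[of s i3 j1 j] row fr' ij by auto
    ultimately have m: "A i3 t * A i j \<le> A i t * A i3 j"
      using minor2[of i3 i j t] fr' ij by (auto simp: mult.commute)
    show ?thesis
    proof (cases "A i3 j = 0")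
      case True
      \<comment> \<open>\<open>A i3 t\<close> plays the role of \<open>h\<close>, so the lower bound
        is not positive.\<close>
      then have "A i3 t = 0"
        using m ij' T.nonneg by (auto simp: mult_le_0_iff)
      then have "T.N \<le> 0" by (rule T.N_nonpos)
      then show ?thesis using T.nonpos_bound pos ij nonneg unfolding D N by auto
    next
      case False
      then have "0 < A i3 j" using nonneg[OF \<open>P i3 j\<close>] by simp
      then show ?thesis
        using scale_cancel[of "T.N" "A i3 j" T.D "A i3 t" "A s j" "A i j" "A i t"] m
          compat_row[OF fr pos, of i3 j] \<open>P i3 j\<close> ij ij' nonneg[of s j] pos unfolding D N
        by (auto simp: mult.commute)
    qed
  next
    case col
    \<comment> \<open>Column \<open>j\<close> then lies left of the frame, and its bound is weaker than the one given by \<open>j1\<close>.\<close>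
    have "j < j1"
    proof (rule ccontr)
      assume "\<not> j < j1"
      moreover have "j1 \<noteq> j" using col ij' by auto
      ultimately show False using linked_lower[of s k j1 j] col fr' ij by auto
    qed
    moreover have "i < k"
    proof (rule ccontr)
      assume "\<not> i < k"
      moreover have "k \<noteq> i" using col ij' by auto
      ultimately show False using linked_upper[of k i j t] col fr' ij by auto
    qed
    then have "P i j1"
      using linked_upper[of i i3 j1 t] col fr' ij by auto
    ultimately have m: "A s j1 * A i j \<le> A s j * A i j1"
      using minor2[of s i j j1] fr' ij by auto
    show ?thesis
    proof (cases "A i j1 = 0")
      case True
      then have "A s j1 = 0"
        using m ij' T.nonneg by (auto simp: mult_le_0_iff)
      then have "T.N \<le> 0" using T.N_nonpos T.b_eq_0 pos D by auto
      then show ?thesis using T.nonpos_bound pos ij nonneg unfolding D N by auto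
    next
      case False
      then have "0 < A i j1" using nonneg[OF \<open>P i j1\<close>] by simp
      then show ?thesis
        using scale_cancel[of "T.N" "A i j1" T.D "A s j1" "A i t" "A i j" "A s j"] m
          compat_col[OF fr pos, of i j1] \<open>P i j1\<close> ij ij' nonneg[of i t] pos unfolding D N
        by auto
    qed
  next
    case full
    have "card {i2, i3, i} = 3" "card {j1, j2, j} = 3"
      using ij' fr' by auto
    moreover have "{i2, i3, i} \<subseteq> {s<..}" "{j1, j2, j} \<subseteq> {..<t}"
      using fr' ij by auto
    moreover have "\<forall>k \<in> {s, i2, i3, i}. \<forall>l \<in> {t, j1, j2, j}. (k, l) \<noteq> (s, t) \<longrightarrow> P k l"
      using full fr' ij by auto
    ultimately have "large_corner P s t" unfolding large_corner_def by blast
    then show ?thesis using not_large by simp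
  qed
qed

lemma fillable:
  "\<exists>x \<ge> 0. (\<forall>i j. s < i \<and> j < t \<and> P s j \<and> P i j \<and> P i t \<longrightarrow> x * A i j \<le> A s j * A i t) \<and>
     (\<forall>i2 i3 j1 j2. frame i2 i3 j1 j2 \<longrightarrow> offset i2 i3 j1 j2 \<le> x * slope i2 i3 j1 j2)"
proof -
  \<comment> \<open>Grouping the four indices into two specified positions places \<open>F\<close>
    inside a finite product.\<close>
  define F where "F = {((i2, j1), (i3, j2)). frame i2 i3 j1 j2 \<and> 0 < slope i2 i3 j1 j2}"
  \<comment> \<open>The element 0 is the constraint from the 1-by-1 minor and also keeps
    \<open>S\<close> nonempty.\<close>
  define S where "S = insert 0 ((\<lambda>((i2, j1), (i3, j2)). offset i2 i3 j1 j2 / slope i2 i3 j1 j2) ` F)"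
  define x where "x = Max S"
  have "F \<subseteq> {(i, j). P i j} \<times> {(i, j). P i j}"
    by (auto simp: F_def frame_def)
  then have "finite S" unfolding S_def
    using finite_P by (meson finite.insertI finite_SigmaI finite_imageI finite_subset)
  have "x \<in> S" unfolding x_def by (rule Max_in[OF \<open>finite S\<close>]) (simp add: S_def)
  have ge: "y \<le> x" if "y \<in> S" for y using that \<open>finite S\<close> by (simp add: x_def)
  show ?thesis
  proof (intro exI[of _ x] conjI allI impI)
    show "0 \<le> x" by (rule ge) (simp add: S_def)
  next
    fix i j assume ij: "s < i \<and> j < t \<and> P s j \<and> P i j \<and> P i t"
    from \<open>x \<in> S\<close> consider "x = 0" | i2 i3 j1 j2 where "frame i2 i3 j1 j2" "0 < slope i2 i3 j1 j2"
      "x = offset i2 i3 j1 j2 / slope i2 i3 j1 j2"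
      by (auto simp: S_def F_def)
    then show "x * A i j \<le> A s j * A i t"
    proof cases
      case 1
      then show ?thesis using nonneg ij by simp
    next
      case 2
      then have "(x * A i j) * slope i2 i3 j1 j2 \<le> (A s j * A i t) * slope i2 i3 j1 j2"
        using compat[OF 2(1,2), of i j] ij by (simp add: mult.commute)
      then show ?thesis using 2(2) by simp
    qed
  next
    fix i2 i3 j1 j2 assume fr: "frame i2 i3 j1 j2"
    show "offset i2 i3 j1 j2 \<le> x * slope i2 i3 j1 j2"
    proof (cases "slope i2 i3 j1 j2 = 0")
      case True
      then show ?thesis using offset_singular[OF fr] by simp
    next
      case False
      then have "0 < slope i2 i3 j1 j2" using slope_nonneg[OF fr] by simp
      moreover have "offset i2 i3 j1 j2 / slope i2 i3 j1 j2 \<le> x"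
        by (rule ge) (use fr calculation in \<open>force simp: S_def F_def\<close>)
      ultimately show ?thesis by (simp add: field_simps)
    qed
  qed
qed

end

section \<open>Submatrices and small minors\<close>

text \<open>Laplace expansion along the first row, in a form that simplification can iterate on
  matrices of explicit size.\<close>

lemma det_mat_Suc:
  fixes f :: "nat \<times> nat \<Rightarrow> 'a :: comm_ring_1"
  shows "det (mat (Suc k) (Suc k) f) =
    (\<Sum>j<Suc k. f (0, j) * ((-1) ^ j * det (mat k k (\<lambda>(a, b). f (Suc a, if b < j then b else Suc b)))))"
proof -
  have "mat_delete (mat (Suc k) (Suc k) f) 0 j = mat k k (\<lambda>(a, b). f (Suc a, if b < j then b else Suc b))" for j
    by (rule eq_matI) (auto simp: mat_delete_def)
  then show ?thesis
    by (subst laplace_expansion_row[of _ "Suc k" 0]) (auto simp: cofactor_def intro!: sum.cong)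
qed

text \<open>Exactly \<open>k\<close> elements of the list lie below \<open>xs ! k\<close>, and this
  count determines \<open>pick\<close>.\<close>

lemma pick_sorted:
  assumes "sorted_wrt (<) xs" "k < length xs"
  shows "pick (set xs) k = xs ! k"
proof -
  have "distinct xs" using assms(1) strict_sorted_iff by blast
  have "l < k" if "l < length xs" "xs ! l < xs ! k" for l
    using that assms sorted_wrt_nth_less[OF assms(1), of k l] by (cases l k rule: linorder_cases) auto
  then have "{a \<in> set xs. a < xs ! k} \<subseteq> (!) xs ` {..<k}"
    by (auto simp: in_set_conv_nth)
  moreover have "(!) xs ` {..<k} \<subseteq> {a \<in> set xs. a < xs ! k}"
    using sorted_wrt_nth_less[OF assms(1)] assms(2) by auto
  moreover have "inj_on ((!) xs) {..<k}"
    using \<open>distinct xs\<close> assms(2) by (intro inj_on_nth) auto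
  ultimately have "card {a \<in> set xs. a < xs ! k} = k"
    by (metis card_image card_lessThan subset_antisym)
  then show ?thesis using pick_card_in_set[of "xs ! k" "set xs"] assms(2) by simp
qed

lemma submatrix_sorted:
  assumes "sorted_wrt (<) xs" "sorted_wrt (<) ys" "set xs \<subseteq> {..<dim_row A}" "set ys \<subseteq> {..<dim_col A}"
  shows "submatrix A (set xs) (set ys) = mat (length xs) (length ys) (\<lambda>(a, b). A $$ (xs ! a, ys ! b))"
proof -
  have "{i. i < dim_row A \<and> i \<in> set xs} = set xs" "{j. j < dim_col A \<and> j \<in> set ys} = set ys"
    using assms by auto
  moreover have "distinct xs" "distinct ys" using assms strict_sorted_iff by blast+
  ultimately show ?thesis
    unfolding submatrix_def using pick_sorted assms by (intro eq_matI) (auto simp: distinct_card)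
qed

lemma submatrix_cong:
  assumes "dim_row A = dim_row B" "dim_col A = dim_col B" "I \<subseteq> {..<dim_row A}" "J \<subseteq> {..<dim_col A}"
    and "\<And>i j. i \<in> I \<Longrightarrow> j \<in> J \<Longrightarrow> A $$ (i, j) = B $$ (i, j)"
  shows "submatrix A I J = submatrix B I J"
proof -
  have "{i. i < dim_row A \<and> i \<in> I} = I" "{j. j < dim_col A \<and> j \<in> J} = J"
    using assms by auto
  then show ?thesis
    unfolding submatrix_def using assms(1,2) assms(5)[OF pick_in_set_le pick_in_set_le]
    by (intro eq_matI) auto
qed

lemma submatrix_full: "submatrix A {..<dim_row A} {..<dim_col A} = A"
  using submatrix_sorted[of "[0..<dim_row A]" "[0..<dim_col A]" A]
  by (auto simp: atLeast0LessThan intro!: eq_matI)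

lemma submatrix_transpose:
  assumes "I \<subseteq> {..<dim_row A}" "J \<subseteq> {..<dim_col A}"
  shows "submatrix (transpose_mat A) J I = transpose_mat (submatrix A I J)"
proof -
  have "{i. i < dim_row A \<and> i \<in> I} = I" "{j. j < dim_col A \<and> j \<in> J} = J"
    using assms by auto
  moreover have "pick I a < dim_row A" if "a < card I" for a using pick_in_set_le[OF that] assms by auto
  moreover have "pick J a < dim_col A" if "a < card J" for a using pick_in_set_le[OF that] assms by auto
  ultimately show ?thesis
    unfolding submatrix_def by (intro eq_matI) auto
qed

lemma dim_submatrix_subset:
  assumes "I \<subseteq> {..<dim_row A}" "J \<subseteq> {..<dim_col A}"
  shows "dim_row (submatrix A I J) = card I" "dim_col (submatrix A I J) = card J"
proof -
  have "{i. i < dim_row A \<and> i \<in> I} = I" "{j. j < dim_col A \<and> j \<in> J} = J"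
    using assms by auto
  then show "dim_row (submatrix A I J) = card I" "dim_col (submatrix A I J) = card J"
    by (simp_all add: dim_submatrix)
qed

lemma det_submatrix_transpose:
  fixes A :: "'a :: comm_ring_1 mat"
  assumes "I \<subseteq> {..<dim_row A}" "J \<subseteq> {..<dim_col A}" "card I = card J"
  shows "det (submatrix (transpose_mat A) J I) = det (submatrix A I J)"
  unfolding submatrix_transpose[OF assms(1,2)]
  using dim_submatrix_subset[OF assms(1,2)] assms(3) by (intro det_transpose[of _ "card I"]) auto

lemma det_submatrix_1:
  fixes A :: "'a :: comm_ring_1 mat"
  assumes "i < dim_row A" "j < dim_col A"
  shows "det (submatrix A {i} {j}) = A $$ (i, j)"
  using submatrix_sorted[of "[i]" "[j]" A] assms by (simp add: det_mat_Suc)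

lemma det_submatrix_2:
  fixes A :: "'a :: comm_ring_1 mat"
  assumes "i < i'" "i' < dim_row A" "j < j'" "j' < dim_col A"
  shows "det (submatrix A {i, i'} {j, j'}) = A $$ (i, j) * A $$ (i', j') - A $$ (i, j') * A $$ (i', j)"
  using submatrix_sorted[of "[i, i']" "[j, j']" A] assms by (simp add: det_mat_Suc)

lemma det_submatrix_3:
  fixes A :: "real mat"
  assumes "i1 < i2" "i2 < i3" "i3 < dim_row A" "j1 < j2" "j2 < j3" "j3 < dim_col A"
  shows "det (submatrix A {i1, i2, i3} {j1, j2, j3}) =
    A $$ (i1, j3) * corner_slope (curry (($$) A)) i2 i3 j1 j2 - corner_offset (curry (($$) A)) i1 j3 i2 i3 j1 j2"
  using submatrix_sorted[of "[i1, i2, i3]" "[j1, j2, j3]" A] assms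
  by (simp add: det_mat_Suc corner_slope_def corner_offset_def algebra_simps)

lemma submatrix_single_unspecified:
  assumes "sorted_wrt (<) xs" "sorted_wrt (<) ys" "set xs \<subseteq> {..<dim_row P}" "set ys \<subseteq> {..<dim_col P}"
    and "a < length xs" "b < length ys"
    and "\<And>i j. i \<in> set xs \<Longrightarrow> j \<in> set ys \<Longrightarrow> P $$ (i, j) \<longleftrightarrow> (i, j) \<noteq> (xs ! a, ys ! b)"
  shows "submatrix P (set xs) (set ys) = single_unspecified (length xs) (length ys) (a, b)"
proof -
  have "distinct xs" "distinct ys" using assms strict_sorted_iff by blast+
  then show ?thesis
    unfolding submatrix_sorted[OF assms(1-4)] single_unspecified_def
    using assms(5-7) by (intro eq_matI) (auto simp: nth_eq_iff_index_eq)
qed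

lemma card_2_obtain:
  assumes "card (I :: 'a :: linorder set) = 2"
  obtains i i' where "I = {i, i'}" "i < i'"
  using assms by (metis card_2_iff insert_commute linorder_neqE)

lemma card_3_obtain:
  assumes "card (I :: 'a :: linorder set) = 3"
  obtains i1 i2 i3 where "I = {i1, i2, i3}" "i1 < i2" "i2 < i3"
proof -
  have I: "finite I" "I \<noteq> {}" using assms card.infinite by fastforce+
  then have "card (I - {Min I}) = 2" using assms by simp
  then obtain i2 i3 where *: "I - {Min I} = {i2, i3}" "i2 < i3" by (rule card_2_obtain)
  moreover have "I = insert (Min I) (I - {Min I})" using Min_in[OF I] by auto
  moreover have "i2 \<in> I - {Min I}" using * by simp
  then have "Min I < i2" using I Min_le[of I i2] by (auto simp: order_less_le)
  ultimately show ?thesis using that by metis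
qed

section \<open>Partial totally nonnegative matrices\<close>

definition specified where
  "specified P i j \<longleftrightarrow> i < dim_row P \<and> j < dim_col P \<and> P $$ (i, j)"

lemma partial_TN_dim: "partial_TN P A \<Longrightarrow> dim_row A = dim_row P \<and> dim_col A = dim_col P"
  by (auto simp: partial_TN_def)

lemma partial_TN_minor:
  assumes "partial_TN P A" "card I = card J" "\<And>i j. i \<in> I \<Longrightarrow> j \<in> J \<Longrightarrow> specified P i j"
    "I \<noteq> {}" "J \<noteq> {}"
  shows "0 \<le> det (submatrix A I J)"
proof -
  have "I \<subseteq> {..<dim_row P}" "J \<subseteq> {..<dim_col P}" using assms(3-5) by (auto simp: specified_def)
  then show ?thesis using assms by (auto simp: partial_TN_def specified_def)
qed

lemma specify_dim [simp]: "dim_row (specify P U) = dim_row P" "dim_col (specify P U) = dim_col P"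
  by (auto simp: specify_def)

lemma specify_index [simp]:
  "i < dim_row P \<Longrightarrow> j < dim_col P \<Longrightarrow> specify P U $$ (i, j) \<longleftrightarrow> P $$ (i, j) \<or> (i, j) \<in> U"
  by (auto simp: specify_def)

lemma corner_of_partial_TN:
  assumes A: "partial_TN P A"
    and linked: "diagonally_linked (specified P)" and not_large: "\<not> large_corner (specified P) s t"
  shows "corner (specified P) (curry (($$) A)) s t"
proof
  show "finite {(i, j). specified P i j}"
    by (rule finite_subset[of _ "{..<dim_row P} \<times> {..<dim_col P}"]) (auto simp: specified_def)
next
  fix i j assume ij: "specified P i j"
  then have "0 \<le> det (submatrix A {i} {j})"
    by (intro partial_TN_minor[OF A]) auto
  then show "0 \<le> curry (($$) A) i j"
    using ij partial_TN_dim[OF A] by (simp add: specified_def det_submatrix_1)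
next
  fix i i' j j' :: nat
  assume *: "i < i'" "j < j'" "specified P i j" "specified P i j'" "specified P i' j" "specified P i' j'"
  then have "0 \<le> det (submatrix A {i, i'} {j, j'})"
    by (intro partial_TN_minor[OF A]) auto
  then show "curry (($$) A) i j' * curry (($$) A) i' j \<le> curry (($$) A) i j * curry (($$) A) i' j'"
    using * partial_TN_dim[OF A] by (simp add: specified_def det_submatrix_2)
next
  fix i1 i2 i3 j1 j2 j3 :: nat
  assume *: "i1 < i2" "i2 < i3" "j1 < j2" "j2 < j3"
    "\<forall>i \<in> {i1, i2, i3}. \<forall>j \<in> {j1, j2, j3}. specified P i j"
  then have "0 \<le> det (submatrix A {i1, i2, i3} {j1, j2, j3})"
    by (intro partial_TN_minor[OF A]) auto
  then show "corner_offset (curry (($$) A)) i1 j3 i2 i3 j1 j2 \<le>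
      curry (($$) A) i1 j3 * corner_slope (curry (($$) A)) i2 i3 j1 j2"
    using * partial_TN_dim[OF A] by (simp add: specified_def det_submatrix_3)
qed (fact linked, fact not_large)

lemma completable_corner:
  assumes st: "s < dim_row P" "t < dim_col P" "\<not> P $$ (s, t)"
    and linked: "diagonally_linked (specified P)" and not_large: "\<not> large_corner (specified P) s t"
    and one_sided: "\<nexists>r u. r < s \<and> t < u \<and> specified P r t \<and> specified P r u \<and> specified P s u"
  shows "TN_completable_subset P {(s, t)}"
  unfolding TN_completable_subset_def
proof (intro allI impI)
  fix A assume A: "partial_TN P A"
  define E where "E = curry (($$) A)"
  interpret corner "specified P" E s t
    unfolding E_def by (rule corner_of_partial_TN[OF A linked not_large])
  obtain x where x0: "0 \<le> x"
    and x2: "\<And>i j. s < i \<Longrightarrow> j < t \<Longrightarrow> specified P s j \<Longrightarrow> specified P i j \<Longrightarrow> specified P i t \<Longrightarrow>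
      x * E i j \<le> E s j * E i t"
    and x3: "\<And>i2 i3 j1 j2. frame i2 i3 j1 j2 \<Longrightarrow> offset i2 i3 j1 j2 \<le> x * slope i2 i3 j1 j2"
    using fillable by blast
  note dimA = partial_TN_dim[OF A]
  define B where "B = mat (dim_row P) (dim_col P) (\<lambda>q. if q = (s, t) then x else A $$ q)"
  have dimB: "dim_row B = dim_row P" "dim_col B = dim_col P" by (auto simp: B_def)
  have B: "B $$ (i, j) = (if (i, j) = (s, t) then x else A $$ (i, j))"
    if "i < dim_row P" "j < dim_col P" for i j using that by (auto simp: B_def)
  have "partial_TN (specify P {(s, t)}) B"
    unfolding partial_TN_def specify_dim
  proof (intro conjI allI impI)
    show "B \<in> carrier_mat (dim_row P) (dim_col P)" by (simp add: B_def)
  next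
    fix I J assume IJ: "I \<subseteq> {..<dim_row P}" "J \<subseteq> {..<dim_col P}"
      and *: "card I = card J \<and> (\<forall>i\<in>I. \<forall>j\<in>J. specify P {(s, t)} $$ (i, j))"
    have spec: "specified P i j" if "i \<in> I" "j \<in> J" "(i, j) \<noteq> (s, t)" for i j
      using * that IJ unfolding specified_def by fastforce
    show "0 \<le> det (submatrix B I J)"
    proof (cases "s \<in> I \<and> t \<in> J")
      case False
      have "B $$ (i, j) = A $$ (i, j)" if "i \<in> I" "j \<in> J" for i j
      proof -
        have "i < dim_row P" "j < dim_col P" using IJ that by auto
        then show ?thesis using B False that by auto
      qed
      then have "submatrix B I J = submatrix A I J"
        using IJ dimA dimB by (intro submatrix_cong) auto
      moreover have "\<forall>i\<in>I. \<forall>j\<in>J. P $$ (i, j)" using spec False by (auto simp: specified_def)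
      ultimately show ?thesis using A IJ * by (simp add: partial_TN_def)
    next
      case True
      define I' J' where "I' = I - {s}" and "J' = J - {t}"
      have I: "I = insert s I'" and J: "J = insert t J'" and fin: "finite I'" "finite J'"
        using True IJ by (auto simp: I'_def J'_def intro: finite_subset)
      have cd: "card I' = card J'" using * True by (simp add: I'_def J'_def)
      \<comment> \<open>Linkedness excludes the two placements in which \<open>(s, t)\<close> and
        \<open>(i, j)\<close> lie on the main diagonal of a 2-by-2 subpattern, and
        \<open>one_sided\<close> excludes \<open>(s, t)\<close> as a lower left entry. Only the
        upper right placement is left.\<close>
      have corner: "s < i \<and> j < t" if ij: "i \<in> I'" "j \<in> J'" for i j
      proof -
        have "specified P i j" "specified P s j" "specified P i t" "i \<noteq> s" "j \<noteq> t" "\<not> specified P s t"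
          using spec[of i j] spec[of s j] spec[of i t] ij True st
          by (auto simp: I'_def J'_def specified_def)
        then show ?thesis
          using linked_upper[of s i t j] linked_lower[of i s j t] one_sided
          by (cases s i rule: linorder_cases; cases t j rule: linorder_cases) auto
      qed
      have sub: "I' \<subseteq> {s<..}" "J' \<subseteq> {..<t}"
        using corner cd fin by (cases "I' = {} \<or> J' = {}"; auto)+
      consider "card I' = 0" | "card I' = 1" | "card I' = 2" | "3 \<le> card I'" by linarith
      then show ?thesis
      proof cases
        case 1
        then have "I = {s}" "J = {t}" using I J cd fin by auto
        then show ?thesis using det_submatrix_1[of s B t] dimB st B x0 by simp
      next
        case 2
        then obtain i j where ij: "I' = {i}" "J' = {j}" using cd by (metis card_1_singletonE)
        then have "I = {s, i}" "J = {j, t}" "s < i" "j < t" using I J sub by auto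
        moreover from this have "i < dim_row P" "j < dim_col P" using IJ by auto
        ultimately show ?thesis
          using det_submatrix_2[of s i B j t] dimB st B x2[of i j] spec by (simp add: E_def)
      next
        case 3
        then obtain i2 i3 j1 j2 where ij: "I' = {i2, i3}" "i2 < i3" "J' = {j1, j2}" "j1 < j2"
          using cd by (metis card_2_obtain)
        then have *: "I = {s, i2, i3}" "J = {j1, j2, t}" "s < i2" "j2 < t" using I J sub by auto
        moreover from this have "i2 < dim_row P" "i3 < dim_row P" "j1 < dim_col P" "j2 < dim_col P"
          using IJ by auto
        moreover have "frame i2 i3 j1 j2" unfolding frame_def using * ij by (auto intro!: spec)
        ultimately show ?thesis
          using det_submatrix_3[of s i2 i3 B j1 j2 t] dimB st B x3[of i2 i3 j1 j2] ij
          by (simp add: corner_slope_def corner_offset_def E_def)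
      next
        case 4
        then obtain I3 J3 where "I3 \<subseteq> I'" "card I3 = 3" "J3 \<subseteq> J'" "card J3 = 3"
          using cd by (metis obtain_subset_with_card_n)
        moreover from this have "I3 \<subseteq> {s<..}" "J3 \<subseteq> {..<t}" "insert s I3 \<subseteq> I" "insert t J3 \<subseteq> J"
          using sub I J by auto
        moreover from this have "\<forall>i \<in> insert s I3. \<forall>j \<in> insert t J3. (i, j) \<noteq> (s, t) \<longrightarrow> specified P i j"
          using spec by blast
        ultimately have "large_corner (specified P) s t"
          unfolding large_corner_def by blast
        then show ?thesis using not_large by simp
      qed
    qed
  qed
  moreover have "agree_on_specified P A B"
    using st by (auto simp: agree_on_specified_def B)
  ultimately show "\<exists>B. agree_on_specified P A B \<and> partial_TN (specify P {(s, t)}) B" by blast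
qed

section \<open>Completable sets of positions and variability\<close>

lemma completable_of_subset:
  assumes "TN_completable_subset P U" "unspecified P \<subseteq> U"
  shows "TN_completable P"
  unfolding TN_completable_def
proof (intro allI impI)
  fix A assume "partial_TN P A"
  then obtain B where B: "agree_on_specified P A B" "partial_TN (specify P U) B"
    using assms(1) by (auto simp: TN_completable_subset_def)
  have "specify P U $$ (i, j)" if "i < dim_row P" "j < dim_col P" for i j
    using assms(2) that by (auto simp: unspecified_def)
  then have "totally_nonneg B"
    using B(2) by (auto simp: totally_nonneg_def partial_TN_def subset_iff)
  then show "\<exists>B\<in>carrier_mat (dim_row P) (dim_col P). agree_on_specified P A B \<and> totally_nonneg B"
    using B by (auto simp: partial_TN_def)
qed

lemma finite_unspecified: "finite (unspecified P)"
  by (rule finite_subset[of _ "{..<dim_row P} \<times> {..<dim_col P}"]) (auto simp: unspecified_def)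

lemma completable_subset_empty: "TN_completable_subset P {}"
proof -
  have "specify P {} = P" by (rule eq_matI) (auto simp: specify_def)
  then show ?thesis by (auto simp: TN_completable_subset_def agree_on_specified_def)
qed

text \<open>The empty set is always completable, which rules out the value 0. The set of all
  unspecified positions is not, so the least size is attained.\<close>

lemma variability_eq_1_iff:
  assumes "\<not> TN_completable P"
  shows "variability P = 1 \<longleftrightarrow> (\<exists>p \<in> unspecified P. \<not> TN_completable_subset P {p})"
proof
  let ?Q = "\<lambda>k. \<exists>U \<subseteq> unspecified P. \<not> TN_completable_subset P U \<and> card U = k"
  have "?Q (card (unspecified P))" using completable_of_subset assms by blast
  then have "?Q (variability P)" unfolding variability_def by (rule LeastI)
  then show "\<exists>p \<in> unspecified P. \<not> TN_completable_subset P {p}" if "variability P = 1"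
    using that by (metis card_1_singletonE insert_subset)
  assume "\<exists>p \<in> unspecified P. \<not> TN_completable_subset P {p}"
  then have "?Q 1" by (metis One_nat_def card.empty card.insert empty_iff empty_subsetI finite.emptyI insert_subset)
  then have "variability P \<le> 1" unfolding variability_def by (rule Least_le)
  moreover have "variability P \<noteq> 0"
    using \<open>?Q (variability P)\<close> completable_subset_empty finite_unspecified
    by (metis card_eq_0_iff finite_subset)
  ultimately show "variability P = 1" by simp
qed

lemma obstruction_minimal:
  assumes "TN_obstruction P" "I \<subseteq> {..<dim_row P}" "J \<subseteq> {..<dim_col P}"
    "\<not> TN_completable (submatrix P I J)"
  shows "I = {..<dim_row P} \<and> J = {..<dim_col P} \<and> submatrix P I J = P"
proof -
  have "I = {..<dim_row P}" "J = {..<dim_col P}"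
    using assms unfolding TN_obstruction_def by blast+
  then show ?thesis by (auto simp: submatrix_full)
qed

section \<open>Invariance under transposition\<close>

lemma partial_TN_transpose:
  assumes "partial_TN P A"
  shows "partial_TN (transpose_mat P) (transpose_mat A)"
  unfolding partial_TN_def
proof (intro conjI allI impI)
  have A: "A \<in> carrier_mat (dim_row P) (dim_col P)" using assms by (simp add: partial_TN_def)
  then show "transpose_mat A \<in> carrier_mat (dim_row (transpose_mat P)) (dim_col (transpose_mat P))" by simp
  fix J I
  assume IJ: "J \<subseteq> {..<dim_row (transpose_mat P)}" "I \<subseteq> {..<dim_col (transpose_mat P)}"
    and *: "card J = card I \<and> (\<forall>j\<in>J. \<forall>i\<in>I. transpose_mat P $$ (j, i))"
  have "P $$ (i, j)" if "i \<in> I" "j \<in> J" for i j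
  proof -
    have "i < dim_row P" "j < dim_col P" using IJ that by auto
    then show ?thesis using * that by (metis index_transpose_mat(1))
  qed
  then have "0 \<le> det (submatrix A I J)"
    using assms IJ * by (simp add: partial_TN_def)
  then show "0 \<le> det (submatrix (transpose_mat A) J I)"
    using det_submatrix_transpose[of I A J] IJ * A by simp
qed

lemma specify_transpose: "specify (transpose_mat P) (prod.swap ` U) = transpose_mat (specify P U)"
  by (rule eq_matI) (auto simp: specify_def)

lemma agree_transpose:
  "agree_on_specified P A B \<Longrightarrow> A \<in> carrier_mat (dim_row P) (dim_col P) \<Longrightarrow> B \<in> carrier_mat (dim_row P) (dim_col P) \<Longrightarrow>
    agree_on_specified (transpose_mat P) (transpose_mat A) (transpose_mat B)"
  by (auto simp: agree_on_specified_def)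

lemma completable_subset_transpose:
  assumes "TN_completable_subset P U"
  shows "TN_completable_subset (transpose_mat P) (prod.swap ` U)"
  unfolding TN_completable_subset_def
proof (intro allI impI)
  fix A assume A: "partial_TN (transpose_mat P) A"
  then have A': "partial_TN P (transpose_mat A)" using partial_TN_transpose by fastforce
  then obtain B where B: "agree_on_specified P (transpose_mat A) B" "partial_TN (specify P U) B"
    using assms by (auto simp: TN_completable_subset_def)
  have "agree_on_specified (transpose_mat P) (transpose_mat (transpose_mat A)) (transpose_mat B)"
    using A' B by (intro agree_transpose) (auto simp: partial_TN_def)
  then show "\<exists>B. agree_on_specified (transpose_mat P) A B \<and> partial_TN (specify (transpose_mat P) (prod.swap ` U)) B"
    using partial_TN_transpose[OF B(2)] by (auto simp: specify_transpose)
qed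

lemma totally_nonneg_transpose:
  assumes "totally_nonneg A"
  shows "totally_nonneg (transpose_mat A)"
  using assms unfolding totally_nonneg_def by (auto simp: det_submatrix_transpose)

lemma completable_transpose:
  assumes "TN_completable P"
  shows "TN_completable (transpose_mat P)"
  unfolding TN_completable_def
proof (intro allI impI)
  fix A assume A: "partial_TN (transpose_mat P) A"
  then have A': "partial_TN P (transpose_mat A)" using partial_TN_transpose by fastforce
  then obtain B where B: "agree_on_specified P (transpose_mat A) B" "totally_nonneg B"
      "B \<in> carrier_mat (dim_row P) (dim_col P)"
    using assms by (auto simp: TN_completable_def)
  have "agree_on_specified (transpose_mat P) (transpose_mat (transpose_mat A)) (transpose_mat B)"
    using A' B by (intro agree_transpose) (auto simp: partial_TN_def)
  then show "\<exists>B\<in>carrier_mat (dim_row (transpose_mat P)) (dim_col (transpose_mat P)).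
      agree_on_specified (transpose_mat P) A B \<and> totally_nonneg B"
    using totally_nonneg_transpose[OF B(2)] B(3) by (intro bexI[of _ "transpose_mat B"]) auto
qed

lemma completable_transpose_iff: "TN_completable (transpose_mat P) \<longleftrightarrow> TN_completable P"
  using completable_transpose[of P] completable_transpose[of "transpose_mat P"] by auto

lemma obstruction_transpose:
  assumes "TN_obstruction P"
  shows "TN_obstruction (transpose_mat P)"
  unfolding TN_obstruction_def
proof (intro conjI allI impI)
  show "\<not> TN_completable (transpose_mat P)"
    using assms by (simp add: TN_obstruction_def completable_transpose_iff)
  fix J I
  assume "J \<subseteq> {..<dim_row (transpose_mat P)}" "I \<subseteq> {..<dim_col (transpose_mat P)}"
    "J \<noteq> {..<dim_row (transpose_mat P)} \<or> I \<noteq> {..<dim_col (transpose_mat P)}"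
  then show "TN_completable (submatrix (transpose_mat P) J I)"
    using assms by (auto simp: TN_obstruction_def submatrix_transpose completable_transpose_iff)
qed

lemma unspecified_transpose: "unspecified (transpose_mat P) = prod.swap ` unspecified P"
  by (force simp: unspecified_def image_iff)

lemma one_variable_transpose:
  assumes "one_variable_TN_obstruction P"
  shows "one_variable_TN_obstruction (transpose_mat P)"
proof -
  have P: "TN_obstruction P" "\<not> TN_completable P" "variability P = 1"
    using assms by (auto simp: one_variable_TN_obstruction_def TN_obstruction_def)
  then obtain p where p: "p \<in> unspecified P" "\<not> TN_completable_subset P {p}"
    using variability_eq_1_iff[OF P(2)] by blast
  have "\<not> TN_completable_subset (transpose_mat P) {prod.swap p}"
    using completable_subset_transpose[of "transpose_mat P" "{prod.swap p}"] p by auto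
  moreover have "prod.swap p \<in> unspecified (transpose_mat P)"
    using p by (simp add: unspecified_transpose)
  ultimately have "variability (transpose_mat P) = 1"
    using P(2) variability_eq_1_iff[of "transpose_mat P"] by (auto simp: completable_transpose_iff)
  then show ?thesis
    using obstruction_transpose[OF P(1)] by (simp add: one_variable_TN_obstruction_def)
qed

section \<open>Patterns without a completion\<close>

lemma single_unspecified_dim [simp]:
  "dim_row (single_unspecified m n p) = m" "dim_col (single_unspecified m n p) = n"
  by (auto simp: single_unspecified_def)

lemma single_unspecified_index [simp]:
  "i < m \<Longrightarrow> j < n \<Longrightarrow> single_unspecified m n p $$ (i, j) \<longleftrightarrow> (i, j) \<noteq> p"
  by (auto simp: single_unspecified_def)

lemma unspecified_single: "unspecified (single_unspecified m n p) = {p} \<inter> {..<m} \<times> {..<n}"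
  by (auto simp: unspecified_def)

lemma transpose_single_unspecified:
  "transpose_mat (single_unspecified m n (i, j)) = single_unspecified n m (j, i)"
  by (rule eq_matI) (auto simp: single_unspecified_def)

lemma anti_transpose_single_unspecified:
  "i < m \<Longrightarrow> j < n \<Longrightarrow>
    anti_transpose_mat (single_unspecified m n (i, j)) = single_unspecified n m (n - 1 - j, m - 1 - i)"
  by (rule eq_matI) (auto simp: single_unspecified_def anti_transpose_mat_def)

lemma anti_transpose_involution: "anti_transpose_mat (anti_transpose_mat P) = P"
  by (rule eq_matI) (auto simp: anti_transpose_mat_def)

text \<open>The chain is followed backwards from \<open>Q\<close>. Each step can be undone by the
  same reflection, so closure of \<open>S\<close> under the reflections suffices.\<close>

lemma pattern_equiv_closed:
  assumes "pattern_equiv P Q" "Q \<in> S"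
    and "\<And>R. R \<in> S \<Longrightarrow> transpose_mat R \<in> S \<and> anti_transpose_mat R \<in> S"
  shows "P \<in> S"
  using assms(1)[unfolded pattern_equiv_def]
proof (induction rule: converse_rtranclp_induct)
  case base
  then show ?case by fact
next
  case (step P R)
  then have "P = transpose_mat R \<or> P = anti_transpose_mat R"
    by (auto simp: anti_transpose_involution)
  then show ?case using assms(3) step by blast
qed

text \<open>Transposition fixes both patterns and anti-transposition exchanges them.\<close>

lemma pattern_equiv_22:
  "pattern_equiv P (single_unspecified 2 2 (0, 0)) \<longleftrightarrow>
     P = single_unspecified 2 2 (0, 0) \<or> P = single_unspecified 2 2 (1, 1)"
proof
  show "P = single_unspecified 2 2 (0, 0) \<or> P = single_unspecified 2 2 (1, 1)"
    if "pattern_equiv P (single_unspecified 2 2 (0, 0))"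
  proof -
    let ?S = "{single_unspecified 2 2 (0, 0), single_unspecified 2 2 (1, 1)}"
    have "transpose_mat R \<in> ?S \<and> anti_transpose_mat R \<in> ?S" if "R \<in> ?S" for R
      using that by (auto simp: transpose_single_unspecified anti_transpose_single_unspecified)
    then show ?thesis using pattern_equiv_closed[OF that, of ?S] by blast
  qed
  have "single_unspecified 2 2 (0, 0) = anti_transpose_mat (single_unspecified 2 2 (1, 1))"
    by (simp add: anti_transpose_single_unspecified)
  then show "pattern_equiv P (single_unspecified 2 2 (0, 0))"
    if "P = single_unspecified 2 2 (0, 0) \<or> P = single_unspecified 2 2 (1, 1)"
    using that by (auto simp: pattern_equiv_def)
qed

text \<open>Here transposition exchanges the two patterns and anti-transposition fixes each of
  them.\<close>

lemma pattern_equiv_44: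
  "pattern_equiv P (single_unspecified 4 4 (0, 3)) \<longleftrightarrow>
     P = single_unspecified 4 4 (0, 3) \<or> P = single_unspecified 4 4 (3, 0)"
proof
  show "P = single_unspecified 4 4 (0, 3) \<or> P = single_unspecified 4 4 (3, 0)"
    if "pattern_equiv P (single_unspecified 4 4 (0, 3))"
  proof -
    let ?S = "{single_unspecified 4 4 (0, 3), single_unspecified 4 4 (3, 0)}"
    have "transpose_mat R \<in> ?S \<and> anti_transpose_mat R \<in> ?S" if "R \<in> ?S" for R
      using that by (auto simp: transpose_single_unspecified anti_transpose_single_unspecified)
    then show ?thesis using pattern_equiv_closed[OF that, of ?S] by blast
  qed
  have "single_unspecified 4 4 (0, 3) = transpose_mat (single_unspecified 4 4 (3, 0))"
    by (simp add: transpose_single_unspecified)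
  then show "pattern_equiv P (single_unspecified 4 4 (0, 3))"
    if "P = single_unspecified 4 4 (0, 3) \<or> P = single_unspecified 4 4 (3, 0)"
    using that by (auto simp: pattern_equiv_def)
qed

section \<open>Explicit small patterns\<close>

lemma det_submatrix_0: "det (submatrix A {} J) = 1" if "card J = 0" "J \<subseteq> {..<dim_col A}"
  for A :: "real mat"
proof -
  have "J = {}" using that finite_subset by fastforce
  then show ?thesis by (simp add: submatrix_def)
qed

lemma minor_le_1_nonneg:
  fixes A :: "real mat"
  assumes "I \<subseteq> {..<dim_row A}" "J \<subseteq> {..<dim_col A}" "card I = card J" "card I \<le> 1"
    and "\<And>i j. i \<in> I \<Longrightarrow> j \<in> J \<Longrightarrow> 0 \<le> A $$ (i, j)"
  shows "0 \<le> det (submatrix A I J)"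
proof (cases "card I = 0")
  case True
  then have "I = {}" using assms(1) finite_subset by fastforce
  then show ?thesis using det_submatrix_0[of J A] True assms by simp
next
  case False
  then have "card I = 1" using assms by simp
  then obtain i j where "I = {i}" "J = {j}" using assms(3) by (metis card_1_singletonE)
  then show ?thesis using assms by (simp add: det_submatrix_1)
qed

lemma totally_nonneg_entry:
  assumes "totally_nonneg B" "i < dim_row B" "j < dim_col B"
  shows "0 \<le> B $$ (i, j)"
  using assms(1)[unfolded totally_nonneg_def, rule_format, of "{i}" "{j}"] assms
  by (simp add: det_submatrix_1)

lemma totally_nonneg_minor2:
  assumes "totally_nonneg B" "i < i'" "i' < dim_row B" "j < j'" "j' < dim_col B"
  shows "B $$ (i, j') * B $$ (i', j) \<le> B $$ (i, j) * B $$ (i', j')"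
  using assms(1)[unfolded totally_nonneg_def, rule_format, of "{i, i'}" "{j, j'}"] assms
  by (simp add: det_submatrix_2)

text \<open>No minor of size 2 fits, so only the signs of the entries count and every gap can be
  filled with 0.\<close>

lemma completable_small:
  assumes "dim_row P \<le> 1 \<or> dim_col P \<le> 1"
  shows "TN_completable P"
  unfolding TN_completable_def
proof (intro allI impI)
  fix A assume A: "partial_TN P A"
  define B where "B = mat (dim_row P) (dim_col P) (\<lambda>q. if P $$ q then A $$ q else 0)"
  have dimB: "dim_row B = dim_row P" "dim_col B = dim_col P" by (auto simp: B_def)
  have nonneg: "0 \<le> B $$ (i, j)" if "i < dim_row P" "j < dim_col P" for i j
  proof -
    have "0 \<le> det (submatrix A {i} {j})" if "P $$ (i, j)"
      by (rule partial_TN_minor[OF A]) (use that \<open>i < _\<close> \<open>j < _\<close> in \<open>auto simp: specified_def\<close>)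
    then show ?thesis using that partial_TN_dim[OF A] by (auto simp: B_def det_submatrix_1)
  qed
  have "totally_nonneg B"
    unfolding totally_nonneg_def dimB
  proof (intro allI impI)
    fix I J assume IJ: "I \<subseteq> {..<dim_row P}" "J \<subseteq> {..<dim_col P}" "card I = card J"
    then have "card I \<le> dim_row P" "card J \<le> dim_col P"
      by (metis card_lessThan card_mono finite_lessThan)+
    then show "0 \<le> det (submatrix B I J)"
      using IJ assms dimB by (intro minor_le_1_nonneg) (auto intro!: nonneg)
  qed
  moreover have "agree_on_specified P A B" by (auto simp: agree_on_specified_def B_def)
  ultimately show "\<exists>B\<in>carrier_mat (dim_row P) (dim_col P). agree_on_specified P A B \<and> totally_nonneg B"
    using dimB by (intro bexI[of _ B]) auto
qed

lemma not_completable_22: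
  assumes "p = (0, 0) \<or> p = (1, 1)"
  shows "\<not> TN_completable (single_unspecified 2 2 p)" (is "\<not> TN_completable ?P")
proof
  assume compl: "TN_completable ?P"
  \<comment> \<open>The specified diagonal entry is 0, so the full determinant is -1 whatever the
    missing entry is.\<close>
  define A :: "real mat" where "A = mat 2 2 (\<lambda>(i, j). if i = j then 0 else 1)"
  have "partial_TN ?P A"
    unfolding partial_TN_def single_unspecified_dim
  proof (intro conjI allI impI)
    show "A \<in> carrier_mat 2 2" by (simp add: A_def)
    fix I J :: "nat set"
    assume IJ: "I \<subseteq> {..<2}" "J \<subseteq> {..<2}" and *: "card I = card J \<and> (\<forall>i\<in>I. \<forall>j\<in>J. ?P $$ (i, j))"
    have "\<not> 2 \<le> card I"
    proof
      assume "2 \<le> card I"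
      then have "I = {..<2}" "J = {..<2}" using IJ * by (simp_all add: card_seteq)
      then have "?P $$ (fst p, snd p)" using * assms by fastforce
      then show False using assms by auto
    qed
    then show "0 \<le> det (submatrix A I J)"
      using IJ * by (intro minor_le_1_nonneg) (auto simp: A_def subset_iff)
  qed
  then obtain B where B: "B \<in> carrier_mat 2 2" "agree_on_specified ?P A B" "totally_nonneg B"
    using compl by (auto simp: TN_completable_def)
  have "B $$ (0, 1) = 1" "B $$ (1, 0) = 1" "B $$ (0, 0) = 0 \<or> B $$ (1, 1) = 0"
    using B(2) assms by (auto simp: agree_on_specified_def A_def)
  then show False using totally_nonneg_minor2[OF B(3), of 0 1 0 1] B(1) by auto
qed

text \<open>This subpattern appears when the gap at \<open>(1, 0)\<close> is the lower left entry of
  one 2-by-2 minor and the upper right entry of another; linkedness then creates the second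
  gap.\<close>

definition pattern_32 :: "bool mat" where
  "pattern_32 = mat 3 2 (\<lambda>q. q \<noteq> (1, 0) \<and> q \<noteq> (2, 1))"

lemma not_completable_32: "\<not> TN_completable pattern_32"
proof
  assume compl: "TN_completable pattern_32"
  \<comment> \<open>With gaps \<open>x\<close> and \<open>y\<close> the rows are
    \<open>(0, 1)\<close>, \<open>(x, 1)\<close>, \<open>(1, y)\<close>. The first two rows force
    \<open>x = 0\<close>, and the last two require \<open>x * y\<close> to be at least 1.\<close>
  define A :: "real mat" where "A = mat 3 2 (\<lambda>q. if q = (0, 0) then 0 else 1)"
  have dimP: "dim_row pattern_32 = 3" "dim_col pattern_32 = 2" by (auto simp: pattern_32_def)
  have "partial_TN pattern_32 A"
    unfolding partial_TN_def dimP
  proof (intro conjI allI impI)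
    show "A \<in> carrier_mat 3 2" by (simp add: A_def)
    fix I J :: "nat set"
    assume IJ: "I \<subseteq> {..<3}" "J \<subseteq> {..<2}"
      and *: "card I = card J \<and> (\<forall>i\<in>I. \<forall>j\<in>J. pattern_32 $$ (i, j))"
    have "\<not> 2 \<le> card I"
    proof
      assume "2 \<le> card I"
      then have J: "J = {..<2}" using IJ * by (simp_all add: card_seteq)
      have "I \<subseteq> {0}"
      proof
        fix i assume i: "i \<in> I"
        then have "i < 3" using IJ by auto
        moreover have "pattern_32 $$ (i, 0)" "pattern_32 $$ (i, 1)" using * J i by auto
        ultimately show "i \<in> {0}" by (auto simp: pattern_32_def numeral_3_eq_3 less_Suc_eq)
      qed
      then have "card I \<le> 1" by (metis card.empty card.insert card_mono finite.intros empty_iff One_nat_def)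
      then show False using \<open>2 \<le> card I\<close> by simp
    qed
    then show "0 \<le> det (submatrix A I J)"
      using IJ * by (intro minor_le_1_nonneg) (auto simp: A_def subset_iff)
  qed
  then obtain B where B: "B \<in> carrier_mat 3 2" "agree_on_specified pattern_32 A B" "totally_nonneg B"
    using compl by (auto simp: TN_completable_def dimP)
  have b: "B $$ (0, 0) = 0" "B $$ (0, 1) = 1" "B $$ (1, 1) = 1" "B $$ (2, 0) = 1"
    using B(2) by (auto simp: agree_on_specified_def A_def dimP) (auto simp: pattern_32_def)
  have "B $$ (1, 0) \<le> 0" "0 \<le> B $$ (1, 0)" "1 \<le> B $$ (1, 0) * B $$ (2, 1)"
    using totally_nonneg_minor2[OF B(3), of 0 1 0 1] totally_nonneg_entry[OF B(3), of 1 0]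
      totally_nonneg_minor2[OF B(3), of 1 2 0 1] B(1) b by auto
  then have "1 \<le> 0 * B $$ (2, 1)" by (metis order_antisym)
  then show False by simp
qed

text \<open>With \<open>x\<close> in the upper right corner the determinant is
  \<open>- 1 - x\<close>, while all specified minors are nonnegative. The 0 stored at
  \<open>(0, 3)\<close> is a mere placeholder.\<close>

definition witness_44 :: "real mat" where
  "witness_44 = mat 4 4 (\<lambda>(i, j). [[2, 1, 1, 0], [1, 1, 2, 0], [0, 1, 3, 1], [0, 3, 10, 4]] ! i ! j)"

lemma pairs_lt_4:
  fixes i i' :: nat
  assumes "i < i'" "i' < 4"
  shows "(i, i') \<in> {(0,1), (0,2), (0,3), (1,2), (1,3), (2,3)}"
proof -
  have "i' \<in> {1, 2, 3}" using assms by auto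
  then show ?thesis using assms by (auto simp: less_Suc_eq eval_nat_numeral)
qed

lemma witness_44_minor2:
  assumes "i < i'" "i' < 4" "j < j'" "j' < 4" "i \<noteq> 0 \<or> j' \<noteq> 3"
  shows "0 \<le> det (submatrix witness_44 {i, i'} {j, j'})"
proof -
  have "(i, i') \<in> {(0,1), (0,2), (0,3), (1,2), (1,3), (2,3)}"
    "(j, j') \<in> {(0,1), (0,2), (0,3), (1,2), (1,3), (2,3)}"
    using assms pairs_lt_4 by blast+
  moreover have "dim_row witness_44 = 4" "dim_col witness_44 = 4" by (auto simp: witness_44_def)
  moreover have "0 \<le> witness_44 $$ (i, j) * witness_44 $$ (i', j') - witness_44 $$ (i, j') * witness_44 $$ (i', j)"
    using calculation(1,2) assms(5) by (auto simp: witness_44_def)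
  ultimately show ?thesis using assms by (simp add: det_submatrix_2)
qed

lemma witness_44_minor3:
  assumes "i1 < i2" "i2 < i3" "i3 < 4" "j1 < j2" "j2 < j3" "j3 < 4" "i1 \<noteq> 0 \<or> j3 \<noteq> 3"
  shows "0 \<le> det (submatrix witness_44 {i1, i2, i3} {j1, j2, j3})"
proof -
  have "(i1, i2, i3) \<in> {(0,1,2), (0,1,3), (0,2,3), (1,2,3)}"
    "(j1, j2, j3) \<in> {(0,1,2), (0,1,3), (0,2,3), (1,2,3)}"
    using assms by auto
  moreover have "dim_row witness_44 = 4" "dim_col witness_44 = 4" by (auto simp: witness_44_def)
  moreover have "0 \<le> witness_44 $$ (i1, j3) * corner_slope (curry (($$) witness_44)) i2 i3 j1 j2 -
      corner_offset (curry (($$) witness_44)) i1 j3 i2 i3 j1 j2"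
    using calculation(1,2) assms(7) by (auto simp: witness_44_def corner_slope_def corner_offset_def)
  ultimately show ?thesis using assms by (simp add: det_submatrix_3)
qed

lemma det_mat_3:
  fixes f :: "nat \<times> nat \<Rightarrow> 'a :: comm_ring_1"
  shows "det (mat 3 3 f) =
    f (0, 0) * (f (1, 1) * f (2, 2) - f (1, 2) * f (2, 1)) -
    f (0, 1) * (f (1, 0) * f (2, 2) - f (1, 2) * f (2, 0)) +
    f (0, 2) * (f (1, 0) * f (2, 1) - f (1, 1) * f (2, 0))"
  by (simp add: numeral_3_eq_3 numeral_2_eq_2 det_mat_Suc algebra_simps)

lemma det_44_witness:
  fixes x :: real
  shows "det (mat 4 4 (\<lambda>(i, j). [[2, 1, 1, x], [1, 1, 2, 0], [0, 1, 3, 1], [0, 3, 10, 4]] ! i ! j)) = - 1 - x"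
proof -
  have "{..<4 :: nat} = {0, 1, 2, 3}" by auto
  then show ?thesis
    using det_mat_Suc[of 3 "\<lambda>(i, j). [[2, 1, 1, x], [1, 1, 2, 0], [0, 1, 3, 1], [0, 3, 10, 4]] ! i ! j"]
    by (simp add: det_mat_3)
qed

lemma not_completable_44: "\<not> TN_completable (single_unspecified 4 4 (0, 3))" (is "\<not> TN_completable ?P")
proof
  assume compl: "TN_completable ?P"
  have dimA: "dim_row witness_44 = 4" "dim_col witness_44 = 4" by (auto simp: witness_44_def)
  have "partial_TN ?P witness_44"
    unfolding partial_TN_def single_unspecified_dim
  proof (intro conjI allI impI)
    show "witness_44 \<in> carrier_mat 4 4" by (simp add: witness_44_def)
    fix I J :: "nat set"
    assume IJ: "I \<subseteq> {..<4}" "J \<subseteq> {..<4}" and *: "card I = card J \<and> (\<forall>i\<in>I. \<forall>j\<in>J. ?P $$ (i, j))"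
    have no: "i \<noteq> 0 \<or> j \<noteq> 3" if "i \<in> I" "j \<in> J" for i j
      using * that by fastforce
    consider "card I \<le> 1" | "card I = 2" | "card I = 3" | "4 \<le> card I" by linarith
    then show "0 \<le> det (submatrix witness_44 I J)"
    proof cases
      case 1
      have "0 \<le> witness_44 $$ (i, j)" if "i < 4" "j < 4" for i j
        using that by (auto simp: witness_44_def eval_nat_numeral less_Suc_eq)
      then show ?thesis using 1 IJ * dimA by (intro minor_le_1_nonneg) (auto simp: subset_iff)
    next
      case 2
      then obtain i i' j j' where "I = {i, i'}" "i < i'" "J = {j, j'}" "j < j'"
        using * by (metis card_2_obtain)
      then show ?thesis using witness_44_minor2[of i i' j j'] no[of i j'] IJ by simp
    next
      case 3
      then obtain i1 i2 i3 where I: "I = {i1, i2, i3}" "i1 < i2" "i2 < i3" by (rule card_3_obtain)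
      from 3 have "card J = 3" using * by simp
      then obtain j1 j2 j3 where "J = {j1, j2, j3}" "j1 < j2" "j2 < j3" by (rule card_3_obtain)
      then show ?thesis using I witness_44_minor3[of i1 i2 i3 j1 j2 j3] no[of i1 j3] IJ by simp
    next
      case 4
      then have "I = {..<4}" "J = {..<4}" using IJ * by (simp_all add: card_seteq)
      then show ?thesis using no[of 0 3] by simp
    qed
  qed
  then obtain B where B: "B \<in> carrier_mat 4 4" "agree_on_specified ?P witness_44 B" "totally_nonneg B"
    using compl by (auto simp: TN_completable_def)
  define x where "x = B $$ (0, 3)"
  have x: "0 \<le> x" using totally_nonneg_entry[OF B(3), of 0 3] B(1) by (simp add: x_def)
  have "B = mat 4 4 (\<lambda>(i, j). [[2, 1, 1, x], [1, 1, 2, 0], [0, 1, 3, 1], [0, 3, 10, 4]] ! i ! j)"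
  proof (rule eq_matI)
    fix i j :: nat
    let ?M = "mat 4 4 (\<lambda>(i, j). [[2, 1, 1, x], [1, 1, 2, 0], [0, 1, 3, 1], [0, 3, 10, 4]] ! i ! j)"
    assume "i < dim_row ?M" "j < dim_col ?M"
    then have ij: "i < 4" "j < 4" by auto
    show "B $$ (i, j) = ?M $$ (i, j)"
    proof (cases "(i, j) = (0, 3)")
      case False
      then have "B $$ (i, j) = witness_44 $$ (i, j)"
        using B(2) ij unfolding agree_on_specified_def by fastforce
      then show ?thesis using ij False by (auto simp: witness_44_def eval_nat_numeral less_Suc_eq)
    qed (simp add: x_def)
  qed (use B(1) in auto)
  then have "det B = - 1 - x"
    using det_44_witness[of x] by simp
  moreover have "0 \<le> det B"
    using B(1) B(3)[unfolded totally_nonneg_def, rule_format, of "{..<4}" "{..<4}"] submatrix_full[of B]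
    by simp
  ultimately show False using x by simp
qed

section \<open>Classification\<close>

text \<open>By minimality a non-completable subpattern of an obstruction is the whole obstruction.
  The lists give the rows and columns of a copy of such a pattern.\<close>

lemma obstruction_eq_single:
  assumes "TN_obstruction P" "sorted_wrt (<) xs" "sorted_wrt (<) ys"
    and "a < length xs" "b < length ys" "xs ! a < dim_row P" "ys ! b < dim_col P"
    and spec: "\<And>i j. i \<in> set xs \<Longrightarrow> j \<in> set ys \<Longrightarrow> (i, j) \<noteq> (xs ! a, ys ! b) \<Longrightarrow> specified P i j"
    and unspec: "\<not> P $$ (xs ! a, ys ! b)"
    and nc: "\<not> TN_completable (single_unspecified (length xs) (length ys) (a, b))"
  shows "P = single_unspecified (length xs) (length ys) (a, b)"
proof -
  have "distinct xs" "distinct ys" using assms(2,3) strict_sorted_iff by blast+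
  have "i < dim_row P \<and> j < dim_col P" if "i \<in> set xs" "j \<in> set ys" for i j
    using spec[OF that] assms(6,7) by (cases "(i, j) = (xs ! a, ys ! b)") (auto simp: specified_def)
  then have sub: "set xs \<subseteq> {..<dim_row P}" "set ys \<subseteq> {..<dim_col P}"
    using assms(4,5) nth_mem by blast+
  have "P $$ (i, j) \<longleftrightarrow> (i, j) \<noteq> (xs ! a, ys ! b)" if "i \<in> set xs" "j \<in> set ys" for i j
    using spec[OF that] unspec unfolding specified_def by (cases "(i, j) = (xs ! a, ys ! b)") auto
  then have "submatrix P (set xs) (set ys) = single_unspecified (length xs) (length ys) (a, b)"
    using assms(2-5) sub by (intro submatrix_single_unspecified) auto
  then show ?thesis
    using obstruction_minimal[OF assms(1) sub] nc by metis
qed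

text \<open>Each direction of the equivalence can fail only by exhibiting one of the two 2-by-2
  obstructions, which minimality makes the whole pattern.\<close>

lemma diagonally_linked_obstruction:
  assumes P: "TN_obstruction P"
    and ne: "P \<noteq> single_unspecified 2 2 (0, 0)" "P \<noteq> single_unspecified 2 2 (1, 1)"
  shows "diagonally_linked (specified P)"
  unfolding diagonally_linked_def
proof (intro allI impI)
  fix i i' j j' :: nat
  assume *: "i < i'" "j < j'" "specified P i j'" "specified P i' j"
  have "specified P i' j'" if "specified P i j"
  proof (rule ccontr)
    assume "\<not> specified P i' j'"
    then have "P = single_unspecified (length [i, i']) (length [j, j']) (1, 1)"
      using * that not_completable_22[of "(1, 1)"]
      by (intro obstruction_eq_single[OF P]) (auto simp: specified_def numeral_2_eq_2)
    then show False using ne by (simp add: numeral_2_eq_2)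
  qed
  moreover have "specified P i j" if "specified P i' j'"
  proof (rule ccontr)
    assume "\<not> specified P i j"
    then have "P = single_unspecified (length [i, i']) (length [j, j']) (0, 0)"
      using * that not_completable_22[of "(0, 0)"]
      by (intro obstruction_eq_single[OF P]) (auto simp: specified_def numeral_2_eq_2)
    then show False using ne by (simp add: numeral_2_eq_2)
  qed
  ultimately show "specified P i j \<longleftrightarrow> specified P i' j'" by blast
qed

lemma large_corner_obstruction:
  assumes P: "TN_obstruction P" and st: "s < dim_row P" "t < dim_col P" "\<not> P $$ (s, t)"
    and large: "large_corner (specified P) s t"
  shows "P = single_unspecified 4 4 (0, 3)"
proof -
  obtain I J where IJ: "I \<subseteq> {s<..}" "J \<subseteq> {..<t}" "card I = 3" "card J = 3"
    and spec: "\<forall>i \<in> insert s I. \<forall>j \<in> insert t J. (i, j) \<noteq> (s, t) \<longrightarrow> specified P i j"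
    using large unfolding large_corner_def by auto
  obtain i1 i2 i3 where I: "I = {i1, i2, i3}" "i1 < i2" "i2 < i3" using IJ(3) by (rule card_3_obtain)
  obtain j1 j2 j3 where J: "J = {j1, j2, j3}" "j1 < j2" "j2 < j3" using IJ(4) by (rule card_3_obtain)
  have "P = single_unspecified (length [s, i1, i2, i3]) (length [j1, j2, j3, t]) (0, 3)"
  proof (rule obstruction_eq_single[OF P])
    show "specified P i j" if "i \<in> set [s, i1, i2, i3]" "j \<in> set [j1, j2, j3, t]"
      "(i, j) \<noteq> ([s, i1, i2, i3] ! 0, [j1, j2, j3, t] ! 3)" for i j
      using spec[rule_format, of i j] that I(1) J(1) by (auto simp: numeral_3_eq_3)
    show "\<not> TN_completable (single_unspecified (length [s, i1, i2, i3]) (length [j1, j2, j3, t]) (0, 3))"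
      using not_completable_44 by (simp add: eval_nat_numeral)
  qed (use I J IJ st in \<open>auto simp: eval_nat_numeral\<close>)
  then show ?thesis by (simp add: eval_nat_numeral)
qed

lemma submatrix_pattern_32:
  assumes "r < s" "s < i" "t < u" "i < dim_row P" "u < dim_col P"
    and "P $$ (r, t)" "P $$ (r, u)" "\<not> P $$ (s, t)" "P $$ (s, u)" "P $$ (i, t)" "\<not> P $$ (i, u)"
  shows "submatrix P {r, s, i} {t, u} = pattern_32"
proof -
  have "submatrix P (set [r, s, i]) (set [t, u]) =
      mat (length [r, s, i]) (length [t, u]) (\<lambda>(a, b). P $$ ([r, s, i] ! a, [t, u] ! b))"
    using assms by (intro submatrix_sorted) auto
  also have "\<dots> = pattern_32"
    using assms by (intro eq_matI) (auto simp: pattern_32_def less_Suc_eq numeral_3_eq_3 numeral_2_eq_2)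
  finally show ?thesis by simp
qed

text \<open>
  If \<open>(s, t)\<close> were both an upper right and a lower left corner, then \<open>pattern_32\<close> would be a
  subpattern, and a proper one because it misses column \<open>j\<close>.
\<close>

lemma not_two_sided:
  assumes P: "TN_obstruction P" "diagonally_linked (specified P)"
    and st: "\<not> P $$ (s, t)"
    and ru: "r < s" "t < u" "specified P r t" "specified P r u" "specified P s u"
    and ij: "s < i" "j < t" "specified P s j" "specified P i j" "specified P i t"
  shows False
proof -
  have "\<not> specified P s t" using st by (simp add: specified_def)
  \<comment> \<open>In rows \<open>s\<close>, \<open>i\<close> and columns \<open>t\<close>,
    \<open>u\<close> the off-diagonal positions are specified, so the gap at \<open>(s, t)\<close>
    forces one at \<open>(i, u)\<close>.\<close>
  then have "\<not> specified P i u"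
    using P(2) ru ij unfolding diagonally_linked_def by blast
  then have sub: "submatrix P {r, s, i} {t, u} = pattern_32"
    using st ru ij by (intro submatrix_pattern_32) (auto simp: specified_def)
  have "{t, u} = {..<dim_col P}"
    using obstruction_minimal[OF P(1), of "{r, s, i}" "{t, u}"] sub not_completable_32 ru ij
    by (auto simp: specified_def)
  then have "j \<in> {t, u}" using ij by (auto simp: specified_def)
  then show False using ij ru by auto
qed

lemma obstruction_cases:
  assumes P: "TN_obstruction P" and st: "s < dim_row P" "t < dim_col P" "\<not> P $$ (s, t)"
    and nc: "\<not> TN_completable_subset P {(s, t)}"
    and one_sided: "\<nexists>r u. r < s \<and> t < u \<and> specified P r t \<and> specified P r u \<and> specified P s u"
  shows "P = single_unspecified 2 2 (0, 0) \<or> P = single_unspecified 2 2 (1, 1) \<or>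
    P = single_unspecified 4 4 (0, 3)"
proof (rule ccontr)
  assume "\<not> ?thesis"
  then have "diagonally_linked (specified P)" "\<not> large_corner (specified P) s t"
    using diagonally_linked_obstruction large_corner_obstruction P st by blast+
  then show False using completable_corner[OF st _ _ one_sided] nc by blast
qed

lemma one_variable_obstruction_cases:
  assumes "one_variable_TN_obstruction P"
  shows "P = single_unspecified 2 2 (0, 0) \<or> P = single_unspecified 2 2 (1, 1) \<or>
    P = single_unspecified 4 4 (0, 3) \<or> P = single_unspecified 4 4 (3, 0)"
proof -
  have P: "TN_obstruction P" "\<not> TN_completable P" "variability P = 1"
    using assms by (auto simp: one_variable_TN_obstruction_def TN_obstruction_def)
  then obtain p where "p \<in> unspecified P" "\<not> TN_completable_subset P {p}"
    using variability_eq_1_iff[OF P(2)] by blast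
  then obtain s t where st: "s < dim_row P" "t < dim_col P" "\<not> P $$ (s, t)"
    and nc: "\<not> TN_completable_subset P {(s, t)}"
    by (auto simp: unspecified_def)
  show ?thesis
  proof (cases "P = single_unspecified 2 2 (0, 0) \<or> P = single_unspecified 2 2 (1, 1)")
    case False
    then have linked: "diagonally_linked (specified P)"
      using diagonally_linked_obstruction P(1) by blast
    show ?thesis
    proof (cases "\<exists>r u. r < s \<and> t < u \<and> specified P r t \<and> specified P r u \<and> specified P s u")
      case False
      then show ?thesis using obstruction_cases[OF P(1) st nc False] by blast
    next
      case True
      \<comment> \<open>The position is a lower left corner, hence by \<open>not_two_sided\<close>
        never an upper right one. Transposition turns this into the hypothesis
        \<open>one_sided\<close>.\<close>
      have "transpose_mat P = single_unspecified 2 2 (0, 0) \<or> transpose_mat P = single_unspecified 2 2 (1, 1) \<or>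
          transpose_mat P = single_unspecified 4 4 (0, 3)"
      proof (rule obstruction_cases[OF obstruction_transpose[OF P(1)]])
        show "t < dim_row (transpose_mat P)" "s < dim_col (transpose_mat P)" "\<not> transpose_mat P $$ (t, s)"
          using st by auto
        show "\<not> TN_completable_subset (transpose_mat P) {(t, s)}"
          using completable_subset_transpose[of "transpose_mat P" "{(t, s)}"] nc by auto
        have tr: "specified (transpose_mat P) b a \<longleftrightarrow> specified P a b" for a b
          by (auto simp: specified_def)
        show "\<nexists>j i. j < t \<and> s < i \<and> specified (transpose_mat P) j s \<and>
            specified (transpose_mat P) j i \<and> specified (transpose_mat P) t i"
          using True not_two_sided[OF P(1) linked st(3)] unfolding tr by blast
      qed
      then have "P = transpose_mat (single_unspecified 2 2 (0, 0)) \<or>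
          P = transpose_mat (single_unspecified 2 2 (1, 1)) \<or> P = transpose_mat (single_unspecified 4 4 (0, 3))"
        by (metis transpose_transpose)
      then show ?thesis by (auto simp: transpose_single_unspecified)
    qed
  qed auto
qed

section \<open>The listed patterns are 1-variable obstructions\<close>

lemma one_variable_single:
  assumes "p \<in> {..<m} \<times> {..<n}" "\<not> TN_completable (single_unspecified m n p)"
    and "\<And>I J. I \<subseteq> {..<m} \<Longrightarrow> J \<subseteq> {..<n} \<Longrightarrow> I \<noteq> {..<m} \<or> J \<noteq> {..<n} \<Longrightarrow>
      TN_completable (submatrix (single_unspecified m n p) I J)"
  shows "one_variable_TN_obstruction (single_unspecified m n p)"
proof -
  have u: "unspecified (single_unspecified m n p) = {p}" using assms(1) by (auto simp: unspecified_single)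
  then have "\<not> TN_completable_subset (single_unspecified m n p) {p}"
    using completable_of_subset assms(2) by blast
  then have "variability (single_unspecified m n p) = 1"
    using variability_eq_1_iff[OF assms(2)] u by blast
  then show ?thesis
    using assms by (auto simp: one_variable_TN_obstruction_def TN_obstruction_def)
qed

lemma card_proper_subset_lt:
  assumes "I \<subseteq> {..<m :: nat}" "I \<noteq> {..<m}"
  shows "card I < m"
  using psubset_card_mono[of "{..<m}" I] assms by auto

lemma one_variable_22:
  assumes "p = (0, 0) \<or> p = (1, 1)"
  shows "one_variable_TN_obstruction (single_unspecified 2 2 p)"
proof (rule one_variable_single)
  show "TN_completable (submatrix (single_unspecified 2 2 p) I J)"
    if "I \<subseteq> {..<2}" "J \<subseteq> {..<2}" "I \<noteq> {..<2} \<or> J \<noteq> {..<2}" for I J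
  proof (rule completable_small)
    have "card I < 2 \<or> card J < 2"
      using that card_proper_subset_lt by blast
    then show "dim_row (submatrix (single_unspecified 2 2 p) I J) \<le> 1 \<or>
        dim_col (submatrix (single_unspecified 2 2 p) I J) \<le> 1"
      using that by (auto simp: dim_submatrix_subset)
  qed
qed (use assms not_completable_22 in auto)

lemma completable_sub_44:
  assumes IJ: "I \<subseteq> {..<4}" "J \<subseteq> {..<4}" "I \<noteq> {..<4} \<or> J \<noteq> {..<4}"
  shows "TN_completable (submatrix (single_unspecified 4 4 (0, 3)) I J)"
proof -
  define Q where "Q = submatrix (single_unspecified 4 4 (0, 3)) I J"
  have dims: "dim_row Q = card I" "dim_col Q = card J"
    using IJ by (auto simp: Q_def dim_submatrix_subset)
  have "{i. i < 4 \<and> i \<in> I} = I" "{j. j < 4 \<and> j \<in> J} = J" using IJ by auto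
  then have Q: "Q $$ (a, b) \<longleftrightarrow> (pick I a, pick J b) \<noteq> (0, 3)" if "a < card I" "b < card J" for a b
    using that pick_in_set_le[of a I] pick_in_set_le[of b J] IJ unfolding Q_def
    by (subst submatrix_index) (auto simp: subset_iff)
  have "TN_completable Q"
  proof (cases "unspecified Q = {}")
    case True
    then show ?thesis using completable_of_subset completable_subset_empty by blast
  next
    case False
    then obtain s t where st: "s < card I" "t < card J" "\<not> Q $$ (s, t)"
      by (auto simp: unspecified_def dims)
    then have pick: "pick I s = 0" "pick J t = 3" using Q by auto
    have uniq: "a = s \<and> b = t" if "a < card I" "b < card J" "\<not> Q $$ (a, b)" for a b
    proof
      have ab: "pick I a = 0" "pick J b = 3" using Q that by auto
      show "a = s"
        using ab pick pick_mono_le[of a I s] pick_mono_le[of s I a] st that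
        by (cases a s rule: linorder_cases) auto
      show "b = t"
        using ab pick pick_mono_le[of b J t] pick_mono_le[of t J b] st that
        by (cases b t rule: linorder_cases) auto
    qed
    \<comment> \<open>Row 0 is the smallest and column 3 the largest possible index, so a surviving
      gap is the upper right corner of \<open>Q\<close>. It is never on the diagonal of a 2-by-2
      subpattern, which makes linkedness immediate.\<close>
    have first: "\<not> a < s" for a using pick_mono_le[of s I a] pick st by auto
    have last: "\<not> t < b" if "b < card J" for b
    proof -
      have "pick J b < 4" using pick_in_set_le[OF that] IJ by auto
      then show ?thesis using pick_mono_le[OF that, of t] pick by auto
    qed
    have spec: "specified Q a b \<longleftrightarrow> a < card I \<and> b < card J \<and> (a, b) \<noteq> (s, t)" for a b
      using uniq[of a b] st unfolding specified_def dims by auto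
    have "TN_completable_subset Q {(s, t)}"
    proof (rule completable_corner)
      show "s < dim_row Q" "t < dim_col Q" "\<not> Q $$ (s, t)" using st dims by auto
      show "diagonally_linked (specified Q)"
        unfolding diagonally_linked_def
      proof (intro allI impI)
        fix i i' j j' assume "i < i'" "j < j'" "specified Q i j'" "specified Q i' j"
        then show "specified Q i j \<longleftrightarrow> specified Q i' j'"
          using first[of i] last[of j'] unfolding spec by auto
      qed
      show "\<not> large_corner (specified Q) s t"
      proof
        assume "large_corner (specified Q) s t"
        then obtain I' J' where *: "I' \<subseteq> {s<..}" "J' \<subseteq> {..<t}" "card I' = 3" "card J' = 3"
          and sp: "\<forall>i\<in>insert s I'. \<forall>j\<in>insert t J'. (i, j) \<noteq> (s, t) \<longrightarrow> specified Q i j"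
          unfolding large_corner_def by auto
        have "i < card I" if "i \<in> I'" for i using sp[rule_format, of i t] * that unfolding spec by auto
        then have sub: "insert s I' \<subseteq> {..<card I}" "insert t J' \<subseteq> {..<card J}"
          using st * by auto
        have "finite I'" "finite J'" using * by (auto intro: card_ge_0_finite)
        moreover have "s \<notin> I'" "t \<notin> J'" using * by auto
        ultimately have "card (insert s I') = 4" "card (insert t J') = 4" using * by auto
        then have "4 \<le> card I" "4 \<le> card J"
          using card_mono[OF _ sub(1)] card_mono[OF _ sub(2)] by auto
        then show False using IJ card_proper_subset_lt[of I 4] card_proper_subset_lt[of J 4] by linarith
      qed
      show "\<nexists>r u. r < s \<and> t < u \<and> specified Q r t \<and> specified Q r u \<and> specified Q s u"
        using first by blast
    qed
    then show ?thesis
    proof (rule completable_of_subset)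
      show "unspecified Q \<subseteq> {(s, t)}" using uniq unfolding unspecified_def dims by blast
    qed
  qed
  then show ?thesis by (simp add: Q_def)
qed

lemma one_variable_44: "one_variable_TN_obstruction (single_unspecified 4 4 (0, 3))"
  by (rule one_variable_single) (use not_completable_44 completable_sub_44 in auto)

theorem theorem10:
  fixes P :: "bool mat"
  shows "one_variable_TN_obstruction P \<longleftrightarrow>
    pattern_equiv P (single_unspecified 2 2 (0, 0)) \<or>
    pattern_equiv P (single_unspecified 4 4 (0, 3))"
  unfolding pattern_equiv_22 pattern_equiv_44
  using one_variable_obstruction_cases[of P] one_variable_22 one_variable_44
    one_variable_transpose[OF one_variable_44]
  by (auto simp: transpose_single_unspecified)

end
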